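(* The maps $\tau_{(i,j)}$, for $(i,j)$ with $A_{ij}=1$, restrict to maps defined on domains $D_{(i,j)}=\{p\in\Xi(\Lambda_A):\tau_{(i,j)}(p)\in\Xi(\Lambda_A)\}\subset\Xi(\Lambda_A)$. These determine a semibranching function system on $\Xi(\Lambda_A)$ which gives rise to a representation of the Cuntz–Krieger algebra $O_{\tilde A}$ on $L^2(\Xi(\Lambda_A),\mu_s)$, where $\mu_s$ is the Hausdorff measure of dimension $s=\dim_H(\Xi(\Lambda_A))$ and the $D\times D$-matrix $\tilde A$, with rows and columns indexed by the $D$ pairs $(i,j)$ with $A_{ij}=1$, is given by $$\tilde A_{(i,j),(\ell,k)}=\delta_{j,\ell}\,A_{jk}.$$
   Context: Let $N\ge2$ and let $A=(A_{ij})_{i,j=0,\dots,N-1}$ be a matrix with entries in $\{0,1\}$ and $A_{ii}=1$ for all $i$; $D=\#\{(i,j):A_{ij}=1\}$. $\Lambda_A$ is the set of sequences $x=(x_1x_2x_3\dots)$, $x_i\in\{0,\dots,N-1\}$, with $A_{x_ix_{i+1}}=1$ for all $i\ge1$, identified with a subset of $[0,1]$ by $x=\sum_ix_iN^{-i}$; $\sigma$ is the shift $\sigma(x_1x_2x_3\dots)=(x_2x_3\dots)$. $\mathbb{S}_A\subset[0,1]^2$ is the set of pairs $(x,y)$ with $N$-adic digits satisfying $A_{x_k,y_k}=1$ for all $k\ge1$. $\Xi:\Lambda_A\to\mathbb{S}_A$ is the embedding $\Xi(x)=(x,\sigma(x))$. Points of these sets are described by their digit sequences (points with several admissible expansions are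 counted as distinct points, with the Hausdorff measure counted with multiplicity accordingly). For $A_{ij}=1$, $\tau_{(i,j)}:\mathbb{S}_A\to\mathbb{S}_A$, $\tau_{(i,j)}(x,y)=\left(\frac{x+i}{N},\frac{y+j}{N}\right)$, prepends the digit $i$ to $x$ and $j$ to $y$; the coding map is the simultaneous shift $\tau(x,y)=(\sigma(x),\sigma(y))$ of digits. A semibranching function system on a measure space $(X,\mu)$ is a finite family of measurable maps $\sigma_\alpha:D_\alpha\to X$ on measurable subsets $D_\alpha\subset X$, with ranges $R_\alpha=\sigma_\alpha(D_\alpha)$, such that $\mu(X\smallsetminus\bigcup_\alpha R_\alpha)=0$, $\mu(R_\alpha\cap R_\beta)=0$ for $\alpha\ne\beta$, and the Radon–Nikodym derivative $\Phi_{\sigma_\alpha}=d(\mu\circ\sigma_\alpha)/d\mu$ exists and is positive a.e. on $D_\alpha$. With coding map $\tau$ (satisfying $\tau\circ\sigma_\alpha=\mathrm{id}$ on $D_\alpha$), the associated operators are $S_\alpha f=\chi_{R_\alpha}\,(\Phi_{\sigma_\alpha}\circ\tau)^{-1/2}\,(f\circ\tau)$ on $L^2(X,\mu)$; these give the representation if they satisfy the Cuntz–Krieger relations $\sum_\alpha S_\alpha S_\alpha^*=1$, $S_\alpha^*S_\alpha=\sum_\beta\tilde A_{\alpha\beta}S_\beta S_\beta^*$ of $O_{\tilde A}$. *)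

theory Defs
  imports "HOL-Analysis.Analysis"
begin

section \<open>Hausdorff measure and dimension\<close>

text \<open>
  The contribution \<open>(diam U)^s\<close> of a covering set, with the conventions \<open>0^0 = 1\<close> for nonempty
  sets and \<open>0\<close> for the empty set (so that the \<open>0\<close>-dimensional measure is counting measure);
  \<open>powr\<close> alone would give \<open>0 powr 0 = 0\<close>.
\<close>

definition diam_pow :: "real \<Rightarrow> 'a::metric_space set \<Rightarrow> ennreal" where
  "diam_pow s U = (if s = 0 then (if U = {} then 0 else 1) else ennreal (diameter U powr s))"

definition hausdorff_premeasure :: "real \<Rightarrow> real \<Rightarrow> 'a::metric_space set \<Rightarrow> ennreal" where
  "hausdorff_premeasure s \<delta> E =
     (INF U \<in> {U :: nat \<Rightarrow> 'a set. E \<subseteq> (\<Union>n. U n) \<and> (\<forall>n. bounded (U n) \<and> diameter (U n) \<le> \<delta>)}.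
        \<Sum>n. diam_pow s (U n))"

definition hausdorff_outer :: "real \<Rightarrow> 'a::metric_space set \<Rightarrow> ennreal" where
  "hausdorff_outer s E = (SUP \<delta> \<in> {0<..}. hausdorff_premeasure s \<delta> E)"

definition hausdorff_measure :: "real \<Rightarrow> 'a::metric_space measure" where
  "hausdorff_measure s = measure_of UNIV (sets borel) (hausdorff_outer s)"

text \<open>
  Only used for subsets of Euclidean spaces, where the set below is nonempty and bounded below,
  so that the real-valued infimum is meaningful.
\<close>

definition hausdorff_dim :: "'a::metric_space set \<Rightarrow> real" where
  "hausdorff_dim E = Inf {s. 0 \<le> s \<and> hausdorff_outer s E = 0}"

text \<open>
  Hausdorff measure on a set \<open>X\<close> of codes of points, \<open>c\<close> being the map from codes to points:
  every point is counted as often as it has codes, i.e.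
  \<open>E \<mapsto> \<integral> #{e \<in> E. c e = p} dH^s(p)\<close>.
\<close>

definition hausdorff_measure_mult ::
    "('c::topological_space \<Rightarrow> 'a::metric_space) \<Rightarrow> 'c set \<Rightarrow> real \<Rightarrow> 'c measure" where
  "hausdorff_measure_mult c X s = measure_of X (sets (restrict_space borel X))
     (\<lambda>E. \<integral>\<^sup>+p. emeasure (count_space UNIV) {e \<in> E. c e = p} \<partial>hausdorff_measure s)"

section \<open>Digit sequences\<close>

text \<open>The digit \<open>x_k\<close> (\<open>k \<ge> 1\<close>) of the sequence is \<open>x (k - 1)\<close>.\<close>

definition shift :: "(nat \<Rightarrow> nat) \<Rightarrow> nat \<Rightarrow> nat" where
  "shift x = (\<lambda>k. x (Suc k))"

definition digit_value :: "nat \<Rightarrow> (nat \<Rightarrow> nat) \<Rightarrow> real" where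
  "digit_value N x = (\<Sum>k. real (x k) / real N ^ Suc k)"

definition digit_point :: "nat \<Rightarrow> (nat \<Rightarrow> nat) \<times> (nat \<Rightarrow> nat) \<Rightarrow> real \<times> real" where
  "digit_point N = map_prod (digit_value N) (digit_value N)"

definition Lambda :: "nat \<Rightarrow> (nat \<Rightarrow> nat \<Rightarrow> nat) \<Rightarrow> (nat \<Rightarrow> nat) set" where
  "Lambda N A = {x. (\<forall>k. x k < N) \<and> (\<forall>k. A (x k) (x (Suc k)) = 1)}"

definition S_set :: "nat \<Rightarrow> (nat \<Rightarrow> nat \<Rightarrow> nat) \<Rightarrow> ((nat \<Rightarrow> nat) \<times> (nat \<Rightarrow> nat)) set" where
  "S_set N A = {(x, y). (\<forall>k. x k < N \<and> y k < N) \<and> (\<forall>k. A (x k) (y k) = 1)}"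

definition Xi :: "(nat \<Rightarrow> nat) \<Rightarrow> (nat \<Rightarrow> nat) \<times> (nat \<Rightarrow> nat)" where
  "Xi x = (x, shift x)"

definition tau :: "nat \<times> nat \<Rightarrow> (nat \<Rightarrow> nat) \<times> (nat \<Rightarrow> nat) \<Rightarrow> (nat \<Rightarrow> nat) \<times> (nat \<Rightarrow> nat)" where
  "tau = (\<lambda>(i, j). map_prod (case_nat i) (case_nat j))"

definition coding_shift :: "(nat \<Rightarrow> nat) \<times> (nat \<Rightarrow> nat) \<Rightarrow> (nat \<Rightarrow> nat) \<times> (nat \<Rightarrow> nat)" where
  "coding_shift = map_prod shift shift"

definition admissible_pairs :: "nat \<Rightarrow> (nat \<Rightarrow> nat \<Rightarrow> nat) \<Rightarrow> (nat \<times> nat) set" where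
  "admissible_pairs N A = {(i, j). i < N \<and> j < N \<and> A i j = 1}"

definition tau_dom ::
    "nat \<Rightarrow> (nat \<Rightarrow> nat \<Rightarrow> nat) \<Rightarrow> nat \<times> nat \<Rightarrow> ((nat \<Rightarrow> nat) \<times> (nat \<Rightarrow> nat)) set" where
  "tau_dom N A \<alpha> = {p \<in> Xi ` Lambda N A. tau \<alpha> p \<in> Xi ` Lambda N A}"

definition tilde_matrix :: "(nat \<Rightarrow> nat \<Rightarrow> nat) \<Rightarrow> nat \<times> nat \<Rightarrow> nat \<times> nat \<Rightarrow> nat" where
  "tilde_matrix A = (\<lambda>(i, j) (l, k). of_bool (j = l) * A j k)"

text \<open>
  \<open>mu_s\<close>; the dimension is that of the subset of the unit square coded by \<open>\<Xi>(\<Lambda>_A)\<close>.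
\<close>

definition Xi_measure :: "nat \<Rightarrow> (nat \<Rightarrow> nat \<Rightarrow> nat) \<Rightarrow> ((nat \<Rightarrow> nat) \<times> (nat \<Rightarrow> nat)) measure" where
  "Xi_measure N A = hausdorff_measure_mult (digit_point N) (Xi ` Lambda N A)
     (hausdorff_dim (digit_point N ` Xi ` Lambda N A))"

lemma Xi_Lambda_subset: "Xi ` Lambda N A \<subseteq> S_set N A"
  by (auto simp: Xi_def Lambda_def S_set_def shift_def)

lemma tau_S_set: "\<alpha> \<in> admissible_pairs N A \<Longrightarrow> tau \<alpha> ` S_set N A \<subseteq> S_set N A"
  by (auto simp: tau_def S_set_def admissible_pairs_def split: nat.splits)

lemma digit_value_summable:
  assumes "2 \<le> N" "\<forall>k. x k < N"
  shows "summable (\<lambda>k. real (x k) / real N ^ Suc k)"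
proof (rule summable_comparison_test')
  show "summable (\<lambda>k. (1 / real N) ^ k)"
    using assms(1) by (intro summable_geometric) auto
  show "norm (real (x k) / real N ^ Suc k) \<le> (1 / real N) ^ k" if "k \<ge> 0" for k
  proof -
    have "real (x k) \<le> real N" using assms(2) by (simp add: less_imp_le)
    then show ?thesis using assms(1) by (simp add: field_simps)
  qed
qed

lemma digit_value_case_nat:
  assumes "2 \<le> N" "\<forall>k. x k < N"
  shows "digit_value N (case_nat i x) = (digit_value N x + real i) / real N"
proof -
  have s: "summable (\<lambda>k. real (x k) / real N ^ Suc k / real N)"
    using digit_value_summable[OF assms] by (rule summable_divide)
  have "(\<lambda>k. real (case_nat i x (Suc k)) / real N ^ Suc (Suc k))
        = (\<lambda>k. real (x k) / real N ^ Suc k / real N)"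
    by (simp add: field_simps)
  with suminf_split_head[of "\<lambda>k. real (case_nat i x k) / real N ^ Suc k"]
    summable_Suc_iff[of "\<lambda>k. real (case_nat i x k) / real N ^ Suc k"] s
  have "digit_value N (case_nat i x) = (\<Sum>k. real (x k) / real N ^ Suc k / real N) + real i / real N"
    by (simp add: digit_value_def)
  also have "(\<Sum>k. real (x k) / real N ^ Suc k / real N) = digit_value N x / real N"
    unfolding digit_value_def by (rule suminf_divide[OF digit_value_summable[OF assms]])
  finally show ?thesis by (simp add: add_divide_distrib)
qed

lemma digit_point_tau:
  assumes "2 \<le> N" "(x, y) \<in> S_set N A"
  shows "digit_point N (tau (i, j) (x, y)) =
    ((digit_value N x + real i) / real N, (digit_value N y + real j) / real N)"
  using assms by (simp add: digit_point_def tau_def S_set_def digit_value_case_nat)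

section \<open>Semibranching function systems\<close>

text \<open>\<open>\<Phi>\<close> is a Radon--Nikodym derivative of \<open>E \<mapsto> \<mu>(g(E))\<close> with respect to \<open>\<mu>\<close> on \<open>D\<close>.\<close>

definition has_RN_deriv_comp ::
    "'a measure \<Rightarrow> 'a set \<Rightarrow> ('a \<Rightarrow> 'a) \<Rightarrow> ('a \<Rightarrow> real) \<Rightarrow> bool" where
  "has_RN_deriv_comp M D g \<Phi> \<longleftrightarrow>
     \<Phi> \<in> borel_measurable (restrict_space M D) \<and>
     (\<forall>E\<in>sets M. E \<subseteq> D \<longrightarrow>
        g ` E \<in> sets M \<and> emeasure M (g ` E) = (\<integral>\<^sup>+x\<in>E. ennreal (\<Phi> x) \<partial>M))"

definition semibranching_function_system ::
    "'a measure \<Rightarrow> 'i set \<Rightarrow> ('i \<Rightarrow> 'a set) \<Rightarrow> ('i \<Rightarrow> 'a \<Rightarrow> 'a) \<Rightarrow> bool" where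
  "semibranching_function_system M I D g \<longleftrightarrow>
     finite I \<and>
     (\<forall>\<alpha>\<in>I. D \<alpha> \<in> sets M \<and> g \<alpha> \<in> measurable (restrict_space M (D \<alpha>)) M \<and> g \<alpha> ` D \<alpha> \<in> sets M) \<and>
     emeasure M (space M - (\<Union>\<alpha>\<in>I. g \<alpha> ` D \<alpha>)) = 0 \<and>
     (\<forall>\<alpha>\<in>I. \<forall>\<beta>\<in>I. \<alpha> \<noteq> \<beta> \<longrightarrow> emeasure M (g \<alpha> ` D \<alpha> \<inter> g \<beta> ` D \<beta>) = 0) \<and>
     (\<forall>\<alpha>\<in>I. \<exists>\<Phi>. has_RN_deriv_comp M (D \<alpha>) (g \<alpha>) \<Phi> \<and> (AE x in M. x \<in> D \<alpha> \<longrightarrow> 0 < \<Phi> x))"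

definition coding_map ::
    "'a measure \<Rightarrow> 'i set \<Rightarrow> ('i \<Rightarrow> 'a set) \<Rightarrow> ('i \<Rightarrow> 'a \<Rightarrow> 'a) \<Rightarrow> ('a \<Rightarrow> 'a) \<Rightarrow> bool" where
  "coding_map M I D g t \<longleftrightarrow> t \<in> measurable M M \<and> (\<forall>\<alpha>\<in>I. \<forall>x\<in>D \<alpha>. t (g \<alpha> x) = x)"

definition sbfs_operator ::
    "'a set \<Rightarrow> ('a \<Rightarrow> real) \<Rightarrow> ('a \<Rightarrow> 'a) \<Rightarrow> ('a \<Rightarrow> complex) \<Rightarrow> 'a \<Rightarrow> complex" where
  "sbfs_operator R \<Phi> t f =
     (\<lambda>x. indicator R x * complex_of_real (\<Phi> (t x) powr (- 1 / 2)) * f (t x))"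

section \<open>Operators on \<open>L\<^sup>2\<close> and Cuntz--Krieger relations\<close>

text \<open>
  Elements of \<open>L\<^sup>2(M)\<close> are represented by square-integrable functions, equality being
  equality almost everywhere; an operator acts on representatives and has to respect it.
\<close>

definition L2 :: "'a measure \<Rightarrow> ('a \<Rightarrow> complex) set" where
  "L2 M = {f \<in> borel_measurable M. integrable M (\<lambda>x. (norm (f x))\<^sup>2)}"

definition L2_eq :: "'a measure \<Rightarrow> ('a \<Rightarrow> complex) \<Rightarrow> ('a \<Rightarrow> complex) \<Rightarrow> bool" where
  "L2_eq M f g \<longleftrightarrow> (AE x in M. f x = g x)"

definition L2_inner :: "'a measure \<Rightarrow> ('a \<Rightarrow> complex) \<Rightarrow> ('a \<Rightarrow> complex) \<Rightarrow> complex" where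
  "L2_inner M f g = (\<integral>x. f x * cnj (g x) \<partial>M)"

definition L2_norm :: "'a measure \<Rightarrow> ('a \<Rightarrow> complex) \<Rightarrow> real" where
  "L2_norm M f = sqrt (\<integral>x. (norm (f x))\<^sup>2 \<partial>M)"

definition L2_bounded_operator ::
    "'a measure \<Rightarrow> (('a \<Rightarrow> complex) \<Rightarrow> ('a \<Rightarrow> complex)) \<Rightarrow> bool" where
  "L2_bounded_operator M T \<longleftrightarrow>
     (\<forall>f\<in>L2 M. T f \<in> L2 M) \<and>
     (\<forall>f\<in>L2 M. \<forall>g\<in>L2 M. L2_eq M f g \<longrightarrow> L2_eq M (T f) (T g)) \<and>
     (\<forall>f\<in>L2 M. \<forall>g\<in>L2 M. L2_eq M (T (\<lambda>x. f x + g x)) (\<lambda>x. T f x + T g x)) \<and>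
     (\<forall>c. \<forall>f\<in>L2 M. L2_eq M (T (\<lambda>x. c * f x)) (\<lambda>x. c * T f x)) \<and>
     (\<exists>C. \<forall>f\<in>L2 M. L2_norm M (T f) \<le> C * L2_norm M f)"

definition L2_is_adjoint ::
    "'a measure \<Rightarrow> (('a \<Rightarrow> complex) \<Rightarrow> ('a \<Rightarrow> complex)) \<Rightarrow> (('a \<Rightarrow> complex) \<Rightarrow> ('a \<Rightarrow> complex)) \<Rightarrow> bool"
  where
  "L2_is_adjoint M T T' \<longleftrightarrow> L2_bounded_operator M T' \<and>
     (\<forall>f\<in>L2 M. \<forall>g\<in>L2 M. L2_inner M (T f) g = L2_inner M f (T' g))"

text \<open>
  By the universal property of \<open>O_B\<close>, a representation of it on \<open>L\<^sup>2(M)\<close> is a family of partial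
  isometries satisfying the Cuntz--Krieger relations for \<open>B\<close>. Adjoints are unique up to
  \<open>L2_eq\<close>, so it does not matter which representatives \<open>S'\<close> are chosen.
\<close>

definition cuntz_krieger_representation ::
    "'a measure \<Rightarrow> 'i set \<Rightarrow> ('i \<Rightarrow> 'i \<Rightarrow> nat) \<Rightarrow>
      ('i \<Rightarrow> ('a \<Rightarrow> complex) \<Rightarrow> ('a \<Rightarrow> complex)) \<Rightarrow> bool" where
  "cuntz_krieger_representation M I B S \<longleftrightarrow>
     (\<exists>S'.
       (\<forall>\<alpha>\<in>I. L2_bounded_operator M (S \<alpha>) \<and> L2_is_adjoint M (S \<alpha>) (S' \<alpha>)) \<and>
       (\<forall>\<alpha>\<in>I. \<forall>f\<in>L2 M. L2_eq M (S \<alpha> (S' \<alpha> (S \<alpha> f))) (S \<alpha> f)) \<and>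
       (\<forall>f\<in>L2 M. L2_eq M (\<lambda>x. \<Sum>\<alpha>\<in>I. S \<alpha> (S' \<alpha> f) x) f) \<and>
       (\<forall>\<alpha>\<in>I. \<forall>f\<in>L2 M.
          L2_eq M (S' \<alpha> (S \<alpha> f)) (\<lambda>x. \<Sum>\<beta>\<in>I. of_nat (B \<alpha> \<beta>) * S \<beta> (S' \<beta> f) x)))"

end

theory Submission
  imports Defs
begin

text \<open>
  On points of the plane each \<open>tau (i, j)\<close> is a similarity of ratio \<open>1 /
  N\<close>. A similarity of ratio \<open>r\<close> multiplies Hausdorff measure of dimension
  \<open>s\<close> by \<open>r powr s\<close>, and this remains true when points are counted with
  the number of their codes (\<open>emeasure_hausdorff_measure_mult_similarity\<close>). So the
  branches scale the measure by a common constant \<open>c = (1 / N) powr s\<close>, which serves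
  as the Radon--Nikodym derivative. Only this scaling enters the argument; neither finiteness nor
  positivity of the measure is used.

  The combinatorics is that of the shift: the domain of \<open>tau (i, j)\<close> consists of the
  points over sequences that start with \<open>j\<close> (\<open>tau_dom_eq\<close>), its range of
  the points over sequences that start with \<open>i j\<close> (\<open>tau_range_eq\<close>). The
  ranges therefore partition the space, and the domain of \<open>tau (i, j)\<close> is the union
  of the ranges of all \<open>tau (j, k)\<close>.

  For branches that scale the measure by a constant \<open>c\<close>, the operator \<open>f
  \<mapsto> c\<^sup>-\<^sup>1\<^sup>/\<^sup>2 \<chi>\<^sub>R (f \<circ> t)\<close> has the adjoint
  \<open>f \<mapsto> c\<^sup>1\<^sup>/\<^sup>2 \<chi>\<^sub>D (f \<circ> g)\<close>, and the
  products of the two are multiplication by \<open>\<chi>\<^sub>D\<close> and by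
  \<open>\<chi>\<^sub>R\<close>; with the partition above this gives the Cuntz--Krieger relations
  (\<open>cuntz_krieger\<close>). An arbitrary Radon--Nikodym derivative \<open>\<Phi>\<close>
  leads to the same operators: it equals \<open>c\<close> almost everywhere on sets of finite
  measure in its domain, and countably many of these exhaust the part of the domain where a given
  \<open>L\<^sup>2\<close> function is nonzero (\<open>RN_deriv_eq_ratio\<close>).
\<close>

section \<open>Hausdorff measure under similarities\<close>

lemma inj_similarity:
  fixes f :: "'a::metric_space \<Rightarrow> 'b::metric_space"
  assumes f: "\<And>x y. dist (f x) (f y) = r * dist x y" and "0 < r"
  shows "inj f"
proof (rule injI)
  show "x = y" if "f x = f y" for x y
    using f[of x y] that \<open>0 < r\<close> by simp
qed

lemma diameter_similarity:
  assumes f: "\<And>x y. dist (f x) (f y) = r * dist x y" and "0 < r" and "bounded U"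
  shows "bounded (f ` U)" "diameter (f ` U) = r * diameter U"
proof -
  have "dist p q \<le> r * diameter U" if "p \<in> f ` U" "q \<in> f ` U" for p q
    using that diameter_bounded_bound[OF \<open>bounded U\<close>] f \<open>0 < r\<close> by auto
  then show bd: "bounded (f ` U)" 
    unfolding bounded_two_points by blast
  show "diameter (f ` U) = r * diameter U"
  proof (cases "U = {}")
    case False
    have "diameter (f ` U) \<le> r * diameter U"
      unfolding diameter_def using False assms(2) diameter_bounded_bound[OF \<open>bounded U\<close>] f
      by (auto intro!: cSUP_least simp: diameter_def)
    moreover have "diameter U \<le> diameter (f ` U) / r"
    proof -
      have "dist x y \<le> diameter (f ` U) / r" if "x \<in> U" "y \<in> U" for x y
        using diameter_bounded_bound[OF bd, of "f x" "f y"] that f \<open>0 < r\<close>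
        by (simp add: field_simps)
      then show ?thesis
        using False by (subst diameter_def) (auto intro!: cSUP_least)
    qed
    ultimately show ?thesis
      using \<open>0 < r\<close> by (simp add: field_simps)
  qed simp
qed

lemma hausdorff_outer_similarity_le:
  fixes f :: "'a::metric_space \<Rightarrow> 'b::metric_space"
  assumes f: "\<And>x y. dist (f x) (f y) = r * dist x y" and "0 < r"
  shows "ennreal (r powr - s) * hausdorff_outer s (f ` E) \<le> hausdorff_outer s E"
proof -
  have diam: "ennreal (r powr - s) * diam_pow s (f ` U) = diam_pow s U" if "bounded U" for U
  proof -
    have "diameter U \<ge> 0" using that by (rule diameter_ge_0)
    have "r powr - s * (r * diameter U) powr s = diameter U powr s"
      using \<open>0 < r\<close> \<open>diameter U \<ge> 0\<close> by (simp add: powr_mult powr_minus field_simps)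
    then show ?thesis
      using diameter_similarity(2)[OF assms that] \<open>0 < r\<close>
      by (auto simp: diam_pow_def simp flip: ennreal_mult)
  qed
  have "ennreal (r powr - s) * hausdorff_premeasure s \<delta> (f ` E) \<le> hausdorff_outer s E"
    if "0 < \<delta>" for \<delta>
  proof -
    have "ennreal (r powr - s) * hausdorff_premeasure s \<delta> (f ` E)
        \<le> hausdorff_premeasure s (\<delta> / r) E"
      unfolding hausdorff_premeasure_def[of s "\<delta> / r" E]
    proof (rule INF_greatest, clarsimp)
      fix U :: "nat \<Rightarrow> 'a set"
      assume U: "E \<subseteq> (\<Union>n. U n)" "\<forall>n. bounded (U n) \<and> diameter (U n) \<le> \<delta> / r"
      have "hausdorff_premeasure s \<delta> (f ` E) \<le> (\<Sum>n. diam_pow s (f ` U n))"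
        unfolding hausdorff_premeasure_def
      proof (rule INF_lower, clarsimp, intro conjI allI)
        show "f ` E \<subseteq> (\<Union>n. f ` U n)" using U(1) by blast
        show "bounded (f ` U n)" "diameter (f ` U n) \<le> \<delta>" for n
          using diameter_similarity[OF assms, of "U n"] U(2) \<open>0 < r\<close> by (auto simp: field_simps)
      qed
      then have "ennreal (r powr - s) * hausdorff_premeasure s \<delta> (f ` E)
          \<le> ennreal (r powr - s) * (\<Sum>n. diam_pow s (f ` U n))"
        by (rule mult_left_mono) simp
      also have "\<dots> = (\<Sum>n. diam_pow s (U n))"
        using U(2) by (simp add: diam flip: ennreal_suminf_cmult)
      finally show "ennreal (r powr - s) * hausdorff_premeasure s \<delta> (f ` E)
          \<le> (\<Sum>n. diam_pow s (U n))" .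
    qed
    also have "\<dots> \<le> hausdorff_outer s E"
      unfolding hausdorff_outer_def using that \<open>0 < r\<close> by (intro SUP_upper) simp
    finally show ?thesis .
  qed
  then show ?thesis
    unfolding hausdorff_outer_def[of s "f ` E"]
    by (subst SUP_mult_left_ennreal) (auto intro: SUP_least)
qed

lemma hausdorff_outer_similarity:
  fixes f :: "'a::metric_space \<Rightarrow> 'b::metric_space"
  assumes f: "\<And>x y. dist (f x) (f y) = r * dist x y" and "0 < r" and "surj f"
  shows "hausdorff_outer s (f ` E) = ennreal (r powr s) * hausdorff_outer s E"
proof -
  have inj: "inj f"
    using f \<open>0 < r\<close> by (rule inj_similarity)
  have "dist (inv f p) (inv f q) = 1 / r * dist p q" for p q
    using f[of "inv f p" "inv f q"] \<open>surj f\<close> \<open>0 < r\<close> by (simp add: surj_f_inv_f field_simps)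
  \<comment> \<open>The inverse of \<open>f\<close> is a similarity with ratio \<open>1 / r\<close>.\<close>
  from hausdorff_outer_similarity_le[OF this, of s "f ` E"]
  have "ennreal ((1 / r) powr - s) * hausdorff_outer s E \<le> hausdorff_outer s (f ` E)"
    using inj \<open>0 < r\<close> by (simp add: image_image)
  then have "ennreal (r powr s) * hausdorff_outer s E \<le> hausdorff_outer s (f ` E)"
    using \<open>0 < r\<close> by (simp add: powr_minus powr_divide)
  moreover have "hausdorff_outer s (f ` E) \<le> ennreal (r powr s) * hausdorff_outer s E"
  proof -
    have "hausdorff_outer s (f ` E)
        = ennreal (r powr s) * (ennreal (r powr - s) * hausdorff_outer s (f ` E))"
      using \<open>0 < r\<close> by (simp add: powr_minus flip: mult.assoc ennreal_mult)
    also have "\<dots> \<le> ennreal (r powr s) * hausdorff_outer s E"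
      by (intro mult_left_mono hausdorff_outer_similarity_le assms) auto
    finally show ?thesis .
  qed
  ultimately show ?thesis by simp
qed

text \<open>
  By definition of \<open>measure_of\<close>, the measure built from \<open>hausdorff_outer
  s\<close> assigns to a Borel set either its outer measure, or \<open>0\<close> if the outer
  measure should fail to be countably additive on Borel sets. Scaling holds in both cases, so
  countable additivity need not be discussed.
\<close>

lemma emeasure_hausdorff_measure_similarity:
  fixes f :: "'a::metric_space \<Rightarrow> 'a"
  assumes f: "\<And>x y. dist (f x) (f y) = r * dist x y" and "0 < r" and "surj f"
    and E: "E \<in> sets borel" "f ` E \<in> sets borel"
  shows "emeasure (hausdorff_measure s) (f ` E)
    = ennreal (r powr s) * emeasure (hausdorff_measure s) E"
  using E hausdorff_outer_similarity[OF f \<open>0 < r\<close> \<open>surj f\<close>, of s E]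
  by (auto simp: hausdorff_measure_def emeasure_measure_of_conv sets.sigma_sets_eq[of borel, simplified])

text \<open>
  Half of a change of variables. The integral \<open>nn_integral\<close> is a supremum over simple
  functions below the integrand, hence makes sense for non-measurable \<open>f\<close> too. With
  this generality the number of codes of a point in a given set, which is the integrand used
  below, need not be shown to be measurable.
\<close>

lemma nn_integral_comp_ge:
  assumes g: "g \<in> measurable M M" and M: "distr M M g = scale_measure c M"
  shows "c * (\<integral>\<^sup>+x. f x \<partial>M) \<le> (\<integral>\<^sup>+x. f (g x) \<partial>M)"
proof -
  have "c * (\<integral>\<^sup>+x. f x \<partial>M) = (SUP h \<in> {h. simple_function M h \<and> h \<le> f}. c * integral\<^sup>S M h)"
    unfolding nn_integral_def by (rule SUP_mult_left_ennreal)
  also have "\<dots> \<le> (\<integral>\<^sup>+x. f (g x) \<partial>M)"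
  proof (rule SUP_least, clarsimp)
    fix h assume h: "simple_function M h" "h \<le> f"
    have "c * integral\<^sup>S M h = (\<integral>\<^sup>+x. h x \<partial>scale_measure c M)"
      using h(1) by (simp add: nn_integral_scale_measure nn_integral_eq_simple_integral borel_measurable_simple_function)
    also have "\<dots> = (\<integral>\<^sup>+x. h (g x) \<partial>M)"
      using h(1) g by (simp flip: M add: nn_integral_distr borel_measurable_simple_function)
    also have "\<dots> \<le> (\<integral>\<^sup>+x. f (g x) \<partial>M)"
      using h(2) by (intro nn_integral_mono) (auto simp: le_fun_def)
    finally show "c * integral\<^sup>S M h \<le> (\<integral>\<^sup>+x. f (g x) \<partial>M)" .
  qed
  finally show ?thesis .
qed

lemma nn_integral_hausdorff_measure_similarity:
  fixes f :: "'a::metric_space \<Rightarrow> 'a"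
  assumes f: "\<And>x y. dist (f x) (f y) = r * dist x y" and "0 < r" and "surj f"
  shows "(\<integral>\<^sup>+p. h p \<partial>hausdorff_measure s)
    = ennreal (r powr s) * (\<integral>\<^sup>+p. h (f p) \<partial>hausdorff_measure s)"
proof -
  let ?H = "hausdorff_measure s :: 'a measure"
  have sets_H: "sets ?H = sets borel" "space ?H = UNIV"
    by (simp_all add: hausdorff_measure_def sets.sigma_sets_eq[of borel, simplified])
  have inj: "inj f"
    using f \<open>0 < r\<close> by (rule inj_similarity)
  define g where "g = inv f"
  have fg: "f (g p) = p" for p using \<open>surj f\<close> by (simp add: g_def surj_f_inv_f)
  have gf: "g (f p) = p" for p using inj by (simp add: g_def)
  have g: "dist (g p) (g q) = 1 / r * dist p q" for p q
    using f[of "g p" "g q"] \<open>0 < r\<close> by (simp add: fg field_simps)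
  have cont: "continuous_on UNIV k" if "\<And>x y. dist (k x) (k y) = t * dist x y" "0 < t"
    for k :: "'a \<Rightarrow> 'a" and t
    using that(2) by (auto intro!: lipschitz_on_continuous_on[of t] lipschitz_onI simp: that(1))
  have meas: "f \<in> measurable ?H ?H" "g \<in> measurable ?H ?H"
    using cont[OF f \<open>0 < r\<close>] cont[OF g] \<open>0 < r\<close>
    by (auto simp: measurable_cong_sets[OF sets_H(1) sets_H(1)]
        intro!: borel_measurable_continuous_onI)
  have vg: "g -` E = f ` E" for E
    by (rule set_eqI) (use fg gf in \<open>force intro: image_eqI[of _ f, OF fg[symmetric]]\<close>)
  have vf: "f -` E = g ` E" for E
    by (rule set_eqI) (use fg gf in \<open>force intro: image_eqI[of _ g, OF gf[symmetric]]\<close>)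
  have "surj g" using gf by (rule surjI)
  have "distr ?H ?H g = scale_measure (ennreal (r powr s)) ?H"
  proof (rule measure_eqI)
    fix E assume "E \<in> sets (distr ?H ?H g)"
    then have E: "E \<in> sets ?H" by simp
    then have "f ` E \<in> sets ?H"
      using measurable_sets[OF meas(2) E] by (simp add: vg sets_H)
    then show "emeasure (distr ?H ?H g) E = emeasure (scale_measure (ennreal (r powr s)) ?H) E"
      using E emeasure_hausdorff_measure_similarity[OF f \<open>0 < r\<close> \<open>surj f\<close>, of E s]
      by (simp add: emeasure_distr meas vg sets_H)
  qed simp
  \<comment> \<open>The two inequalities come from the same lemma, applied to \<open>f\<close> and to its inverse.\<close>
  from nn_integral_comp_ge[OF meas(2) this, of "\<lambda>p. h (f p)"]
  have le: "ennreal (r powr s) * (\<integral>\<^sup>+p. h (f p) \<partial>?H) \<le> (\<integral>\<^sup>+p. h p \<partial>?H)"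
    by (simp add: fg)
  have "distr ?H ?H f = scale_measure (ennreal ((1 / r) powr s)) ?H"
  proof (rule measure_eqI)
    fix E assume "E \<in> sets (distr ?H ?H f)"
    then have E: "E \<in> sets ?H" by simp
    moreover have "g ` E \<in> sets ?H"
      using measurable_sets[OF meas(1) E] by (simp add: vf sets_H)
    ultimately show "emeasure (distr ?H ?H f) E
        = emeasure (scale_measure (ennreal ((1 / r) powr s)) ?H) E"
      using emeasure_hausdorff_measure_similarity[OF g _ \<open>surj g\<close>, of E s] \<open>0 < r\<close>
      by (simp add: emeasure_distr meas vf sets_H)
  qed simp
  from nn_integral_comp_ge[OF meas(1) this, of h]
  have "ennreal (r powr s) * (ennreal ((1 / r) powr s) * (\<integral>\<^sup>+p. h p \<partial>?H))
      \<le> ennreal (r powr s) * (\<integral>\<^sup>+p. h (f p) \<partial>?H)"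
    by (rule mult_left_mono) simp
  then have "(\<integral>\<^sup>+p. h p \<partial>?H) \<le> ennreal (r powr s) * (\<integral>\<^sup>+p. h (f p) \<partial>?H)"
    using \<open>0 < r\<close> by (simp add: powr_divide flip: mult.assoc ennreal_mult)
  with le show ?thesis by simp
qed

lemma space_hausdorff_measure_mult: "space (hausdorff_measure_mult c X s) = X"
  by (simp add: hausdorff_measure_mult_def space_measure_of_conv)

lemma sets_hausdorff_measure_mult:
  "sets (hausdorff_measure_mult c X s) = sets (restrict_space borel X)"
proof -
  have "sets (restrict_space borel X) \<subseteq> Pow X"
    using sets.sets_into_space[of _ "restrict_space borel X"] by (auto simp: space_restrict_space)
  then show ?thesis
    using sets.sigma_sets_eq[of "restrict_space borel X"]
    by (simp add: hausdorff_measure_mult_def space_restrict_space)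
qed

text \<open>
  If the map \<open>k\<close> on codes covers a similarity \<open>f\<close> of the ambient space,
  then \<open>k ` E\<close> has as many codes of \<open>f p\<close> as \<open>E\<close> has codes
  of \<open>p\<close>, so measures with multiplicity scale like the Hausdorff measure. Here too
  \<open>measure_of\<close> may give the zero measure, which scales as well.
\<close>

lemma emeasure_hausdorff_measure_mult_similarity:
  fixes f :: "'a::metric_space \<Rightarrow> 'a"
  assumes f: "\<And>x y. dist (f x) (f y) = r * dist x y" and "0 < r" and "surj f"
    and k: "inj_on k E" "\<And>e. e \<in> E \<Longrightarrow> c (k e) = f (c e)"
    and E: "E \<in> sets (restrict_space borel X)" "k ` E \<in> sets (restrict_space borel X)"
  shows "emeasure (hausdorff_measure_mult c X s) (k ` E)
    = ennreal (r powr s) * emeasure (hausdorff_measure_mult c X s) E"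
proof -
  have "inj f"
    using f \<open>0 < r\<close> by (rule inj_similarity)
  let ?n = "\<lambda>E p. emeasure (count_space UNIV) {e \<in> E. c e = p}"
  have count: "?n (k ` E) (f p) = ?n E p" for p
  proof -
    have "{e \<in> k ` E. c e = f p} = k ` {e \<in> E. c e = p}"
      using k(2) injD[OF \<open>inj f\<close>] by auto
    moreover have "inj_on k {e \<in> E. c e = p}"
      using k(1) by (rule inj_on_subset) auto
    ultimately show ?thesis
      by (cases "finite {e \<in> E. c e = p}")
        (simp_all add: emeasure_count_space card_image finite_image_iff)
  qed
  have "(\<integral>\<^sup>+p. ?n (k ` E) p \<partial>hausdorff_measure s)
      = ennreal (r powr s) * (\<integral>\<^sup>+p. ?n E p \<partial>hausdorff_measure s)"
    using nn_integral_hausdorff_measure_similarity[OF f \<open>0 < r\<close> \<open>surj f\<close>,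
        where h = "?n (k ` E)" and s = s]
    by (simp add: count)
  moreover have "E \<in> sigma_sets X (sets (restrict_space borel X))"
    "k ` E \<in> sigma_sets X (sets (restrict_space borel X))"
    using E by (auto intro: sigma_sets.Basic)
  ultimately show ?thesis
    by (simp add: hausdorff_measure_mult_def emeasure_measure_of_conv)
qed

section \<open>Square-integrable functions and operators up to null sets\<close>

lemma L2_cong_AE:
  assumes "f \<in> L2 M" "f' \<in> borel_measurable M" "L2_eq M f' f"
  shows "f' \<in> L2 M" "L2_norm M f' = L2_norm M f"
proof -
  have ae: "AE x in M. (norm (f' x))\<^sup>2 = (norm (f x))\<^sup>2"
    using assms(3) unfolding L2_eq_def by eventually_elim simp
  have m: "(\<lambda>x. (norm (f' x))\<^sup>2) \<in> borel_measurable M" "(\<lambda>x. (norm (f x))\<^sup>2) \<in> borel_measurable M"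
    using assms by (auto simp: L2_def)
  show "f' \<in> L2 M"
    using assms integrable_cong_AE[OF m ae] by (auto simp: L2_def)
  show "L2_norm M f' = L2_norm M f"
    unfolding L2_norm_def using integral_cong_AE[OF m ae] by simp
qed

lemma L2_add:
  assumes "f \<in> L2 M" "k \<in> L2 M"
  shows "(\<lambda>x. f x + k x) \<in> L2 M"
proof -
  have [measurable]: "f \<in> borel_measurable M" "k \<in> borel_measurable M"
    using assms by (auto simp: L2_def)
  have "integrable M (\<lambda>x. 2 * (norm (f x))\<^sup>2 + 2 * (norm (k x))\<^sup>2)"
    using assms by (auto simp: L2_def)
  then have "integrable M (\<lambda>x. (norm (f x + k x))\<^sup>2)"
  proof (rule Bochner_Integration.integrable_bound)
    have "(norm (a + b))\<^sup>2 \<le> 2 * (norm a)\<^sup>2 + 2 * (norm b)\<^sup>2" for a b :: complex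
    proof -
      have "(norm (a + b))\<^sup>2 \<le> (norm a + norm b)\<^sup>2"
        by (intro power_mono norm_triangle_ineq) simp
      also have "\<dots> \<le> 2 * (norm a)\<^sup>2 + 2 * (norm b)\<^sup>2"
        using sum_squares_bound[of "norm a" "norm b"] by (simp add: power2_sum)
      finally show ?thesis .
    qed
    then show "AE x in M. norm ((norm (f x + k x))\<^sup>2) \<le> norm (2 * (norm (f x))\<^sup>2 + 2 * (norm (k x))\<^sup>2)"
      by simp
  qed simp
  then show ?thesis by (simp add: L2_def)
qed

lemma L2_cmult: "f \<in> L2 M \<Longrightarrow> (\<lambda>x. a * f x) \<in> L2 M"
  by (auto simp: L2_def norm_mult power_mult_distrib intro: borel_measurable_times)

lemma L2_restrict:
  assumes "f \<in> L2 M" and [measurable]: "E \<in> sets M"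
  shows "integrable M (\<lambda>x. indicator E x *\<^sub>R (norm (f x))\<^sup>2)"
    and "(\<integral>x. indicator E x *\<^sub>R (norm (f x))\<^sup>2 \<partial>M) \<le> (\<integral>x. (norm (f x))\<^sup>2 \<partial>M)"
proof -
  have f: "integrable M (\<lambda>x. (norm (f x))\<^sup>2)"
    using assms by (simp add: L2_def)
  show int: "integrable M (\<lambda>x. indicator E x *\<^sub>R (norm (f x))\<^sup>2)"
    by (rule integrable_mult_indicator[OF \<open>E \<in> sets M\<close> f])
  show "(\<integral>x. indicator E x *\<^sub>R (norm (f x))\<^sup>2 \<partial>M) \<le> (\<integral>x. (norm (f x))\<^sup>2 \<partial>M)"
    by (intro integral_mono int f) (auto simp: indicator_def)
qed

lemma L2_bounded_operator_L2: "L2_bounded_operator M T \<Longrightarrow> f \<in> L2 M \<Longrightarrow> T f \<in> L2 M"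
  by (simp add: L2_bounded_operator_def)

lemma L2_bounded_operator_respects:
  "L2_bounded_operator M T \<Longrightarrow> f \<in> L2 M \<Longrightarrow> k \<in> L2 M \<Longrightarrow> L2_eq M f k \<Longrightarrow> L2_eq M (T f) (T k)"
  by (simp add: L2_bounded_operator_def)

lemma L2_eq_trans [trans]:
  assumes "L2_eq M f k" "L2_eq M k h"
  shows "L2_eq M f h"
  using assms unfolding L2_eq_def by eventually_elim simp

lemma L2_eq_sym:
  assumes "L2_eq M f k"
  shows "L2_eq M k f"
  using assms unfolding L2_eq_def by eventually_elim simp

text \<open>
  Operators are functions on representatives, so two maps \<open>S\<close> and \<open>T\<close>
  describe the same operator when \<open>S f\<close> and \<open>T f\<close> agree almost
  everywhere for every \<open>f\<close> in \<open>L\<^sup>2\<close>.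
\<close>

context
  fixes M :: "'a measure" and S T :: "('a \<Rightarrow> complex) \<Rightarrow> 'a \<Rightarrow> complex"
  assumes T: "L2_bounded_operator M T"
    and meas: "\<And>f. f \<in> L2 M \<Longrightarrow> S f \<in> borel_measurable M"
    and eq: "\<And>f. f \<in> L2 M \<Longrightarrow> L2_eq M (S f) (T f)"
begin

lemma L2_bounded_operator_cong: "L2_bounded_operator M S"
  unfolding L2_bounded_operator_def
proof (intro conjI ballI allI impI)
  show "S f \<in> L2 M" if "f \<in> L2 M" for f
    using L2_cong_AE(1)[OF L2_bounded_operator_L2[OF T that] meas[OF that] eq[OF that]] .
  show "L2_eq M (S f) (S k)" if "f \<in> L2 M" "k \<in> L2 M" "L2_eq M f k" for f k
    using that by (meson eq L2_eq_trans L2_eq_sym L2_bounded_operator_respects[OF T])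
  show "L2_eq M (S (\<lambda>x. f x + k x)) (\<lambda>x. S f x + S k x)" if "f \<in> L2 M" "k \<in> L2 M" for f k
  proof -
    have "L2_eq M (T (\<lambda>x. f x + k x)) (\<lambda>x. T f x + T k x)"
      using T that by (simp add: L2_bounded_operator_def)
    with eq[OF L2_add[OF that]] eq[OF that(1)] eq[OF that(2)] show ?thesis
      unfolding L2_eq_def by eventually_elim simp
  qed
  show "L2_eq M (S (\<lambda>x. a * f x)) (\<lambda>x. a * S f x)" if "f \<in> L2 M" for a f
  proof -
    have "L2_eq M (T (\<lambda>x. a * f x)) (\<lambda>x. a * T f x)"
      using T that by (simp add: L2_bounded_operator_def)
    with eq[OF L2_cmult[OF that, of a]] eq[OF that] show ?thesis
      unfolding L2_eq_def by eventually_elim simp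
  qed
  have "L2_norm M (S f) = L2_norm M (T f)" if "f \<in> L2 M" for f
    using L2_cong_AE(2)[OF L2_bounded_operator_L2[OF T that] meas[OF that] eq[OF that]] .
  then show "\<exists>C. \<forall>f\<in>L2 M. L2_norm M (S f) \<le> C * L2_norm M f"
    using T by (auto simp: L2_bounded_operator_def)
qed

lemma L2_is_adjoint_cong:
  assumes "L2_is_adjoint M T T'"
  shows "L2_is_adjoint M S T'"
proof -
  have "L2_inner M (S f) k = L2_inner M (T f) k" if "f \<in> L2 M" "k \<in> L2 M" for f k
    unfolding L2_inner_def
  proof (rule integral_cong_AE)
    have "(\<lambda>x. cnj (k x)) \<in> borel_measurable M"
      using that(2) by (auto simp: L2_def intro: borel_measurable_continuous_on[OF continuous_on_cnj[OF continuous_on_id]])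
    then show "(\<lambda>x. S f x * cnj (k x)) \<in> borel_measurable M" "(\<lambda>x. T f x * cnj (k x)) \<in> borel_measurable M"
      using meas[OF that(1)] L2_bounded_operator_L2[OF T that(1)] by (auto simp: L2_def)
    show "AE x in M. S f x * cnj (k x) = T f x * cnj (k x)"
      using eq[OF that(1)] unfolding L2_eq_def by eventually_elim simp
  qed
  with assms show ?thesis by (simp add: L2_is_adjoint_def)
qed

end

section \<open>A branch that scales the measure by a constant\<close>

text \<open>
  A branch \<open>g\<close> of a function system, with domain \<open>D\<close> and left inverse
  \<open>t\<close>, that multiplies the measure of every measurable subset of \<open>D\<close> by
  the constant \<open>c\<close>. The measure is not assumed to be \<open>\<sigma>\<close>-finite.
\<close>

locale scaling_branch =
  fixes M :: "'a measure" and D :: "'a set" and g t :: "'a \<Rightarrow> 'a" and c :: real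
  assumes c_pos: "0 < c"
    and D_sets [measurable]: "D \<in> sets M"
    and g_measurable: "g \<in> measurable (restrict_space M D) M"
    and t_measurable [measurable]: "t \<in> measurable M M"
    and t_g: "\<And>x. x \<in> D \<Longrightarrow> t (g x) = x"
    and image_sets: "\<And>E. E \<in> sets M \<Longrightarrow> E \<subseteq> D \<Longrightarrow> g ` E \<in> sets M"
    and emeasure_image: "\<And>E. E \<in> sets M \<Longrightarrow> E \<subseteq> D \<Longrightarrow>
      emeasure M (g ` E) = ennreal c * emeasure M E"
begin

lemma range_sets [measurable]: "g ` D \<in> sets M"
  by (simp add: image_sets)

lemma t_range: "x \<in> g ` D \<Longrightarrow> t x \<in> D"
  by (auto simp: t_g)

lemma g_t: "x \<in> g ` D \<Longrightarrow> g (t x) = x"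
  by (auto simp: t_g)

lemma D_subset: "D \<subseteq> space M" and range_subset: "g ` D \<subseteq> space M"
  by (rule sets.sets_into_space, simp)+

lemma distr_coding_map:
  "distr (restrict_space M (g ` D)) (restrict_space M D) t
    = density (restrict_space M D) (\<lambda>_. ennreal c)"
proof (rule measure_eqI)
  fix E assume "E \<in> sets (distr (restrict_space M (g ` D)) (restrict_space M D) t)"
  then have E: "E \<in> sets M" "E \<subseteq> D"
    using D_sets by (auto simp: sets_restrict_space_iff)
  have t: "t \<in> measurable (restrict_space M (g ` D)) (restrict_space M D)"
    using t_range by (intro measurable_restrict_space3) auto
  have "t -` E \<inter> space (restrict_space M (g ` D)) = g ` E"
    using E D_subset range_subset t_g by (auto simp: space_restrict_space)
  then have "emeasure (distr (restrict_space M (g ` D)) (restrict_space M D) t) E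
      = emeasure (restrict_space M (g ` D)) (g ` E)"
    using E by (subst emeasure_distr[OF t]) (auto simp: sets_restrict_space_iff)
  also have "\<dots> = ennreal c * emeasure (restrict_space M D) E"
    using E by (subst (1 2) emeasure_restrict_space) (auto intro: emeasure_image)
  also have "\<dots> = emeasure (density (restrict_space M D) (\<lambda>_. ennreal c)) E"
    using E by (simp add: emeasure_density_const sets_restrict_space_iff)
  finally show "emeasure (distr (restrict_space M (g ` D)) (restrict_space M D) t) E
      = emeasure (density (restrict_space M D) (\<lambda>_. ennreal c)) E" .
qed simp

text \<open>
  Change of variables along \<open>t\<close>, from the range of the branch to its domain. The two
  parts need no integrability assumption, the Bochner integral of a non-integrable function being
  \<open>0\<close>.
\<close>

lemma pullback:
  fixes h :: "'a \<Rightarrow> 'b::{banach, second_countable_topology}"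
  assumes [measurable]: "h \<in> borel_measurable M"
  shows integrable_pullback_iff: "integrable M (\<lambda>x. indicator (g ` D) x *\<^sub>R h (t x))
      \<longleftrightarrow> integrable M (\<lambda>x. indicator D x *\<^sub>R h x)" (is ?int)
    and integral_pullback: "(\<integral>x. indicator (g ` D) x *\<^sub>R h (t x) \<partial>M)
      = c *\<^sub>R (\<integral>x. indicator D x *\<^sub>R h x \<partial>M)" (is ?eq)
proof -
  have t: "t \<in> measurable (restrict_space M (g ` D)) (restrict_space M D)"
    using t_range by (intro measurable_restrict_space3) auto
  have h: "h \<in> borel_measurable (restrict_space M D)"
    by (intro measurable_restrict_space1) simp
  have scale: "integrable N (\<lambda>x. c *\<^sub>R h x) \<longleftrightarrow> integrable N h" for N
    using c_pos integrable_scaleR_right[of "1 / c" N "\<lambda>x. c *\<^sub>R h x"] by auto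
  have "integrable M (\<lambda>x. indicator (g ` D) x *\<^sub>R h (t x))
      \<longleftrightarrow> integrable (distr (restrict_space M (g ` D)) (restrict_space M D) t) h"
    using h by (simp add: integrable_distr_eq[OF t] integrable_restrict_space)
  also have "\<dots> \<longleftrightarrow> integrable M (\<lambda>x. indicator D x *\<^sub>R h x)"
    using h c_pos
    by (simp add: distr_coding_map integrable_density scale flip: integrable_restrict_space)
  finally show ?int .
  have "(\<integral>x. indicator (g ` D) x *\<^sub>R h (t x) \<partial>M)
      = integral\<^sup>L (distr (restrict_space M (g ` D)) (restrict_space M D) t) h"
    using h by (simp add: integral_distr[OF t] integral_restrict_space)
  also have "\<dots> = c *\<^sub>R (\<integral>x. indicator D x *\<^sub>R h x \<partial>M)"
    using h c_pos by (simp add: distr_coding_map integral_density integral_restrict_space)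
  finally show ?eq .
qed

lemma AE_pullback:
  assumes "AE x in M. x \<in> D \<longrightarrow> P x"
  shows "AE x in M. x \<in> g ` D \<longrightarrow> P (t x)"
proof -
  from assms obtain Z where Z: "{x \<in> space M. \<not> (x \<in> D \<longrightarrow> P x)} \<subseteq> Z" "emeasure M Z = 0" "Z \<in> sets M"
    by (rule AE_E)
  have "emeasure M (Z \<inter> D) \<le> emeasure M Z"
    using Z(3) by (intro emeasure_mono) auto
  then have "emeasure M (g ` (Z \<inter> D)) = 0"
    using emeasure_image[of "Z \<inter> D"] Z(2,3) D_sets by simp
  then have "g ` (Z \<inter> D) \<in> null_sets M"
    using Z(3) by (auto intro!: null_setsI image_sets)
  moreover have "{x \<in> space M. \<not> (x \<in> g ` D \<longrightarrow> P (t x))} \<subseteq> g ` (Z \<inter> D)"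
    using Z(1) D_subset by (auto simp: t_g subset_eq)
  ultimately show ?thesis
    by (rule AE_I')
qed

text \<open>
  The operator of the branch when its Radon--Nikodym derivative is taken to be the constant
  \<open>c\<close>. It is a partial isometry with initial space \<open>L\<^sup>2(D)\<close> and
  final space \<open>L\<^sup>2(g ` D)\<close>.
\<close>

definition branch_isometry :: "('a \<Rightarrow> complex) \<Rightarrow> 'a \<Rightarrow> complex" where
  "branch_isometry f x = (if x \<in> g ` D then f (t x) / complex_of_real (sqrt c) else 0)"

text \<open>
  The adjoint of \<open>branch_isometry\<close>.
\<close>

definition branch_coisometry :: "('a \<Rightarrow> complex) \<Rightarrow> 'a \<Rightarrow> complex" where
  "branch_coisometry f x = (if x \<in> D then complex_of_real (sqrt c) * f (g x) else 0)"

lemma branch_isometry_measurable [measurable]: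
  assumes [measurable]: "f \<in> borel_measurable M"
  shows "branch_isometry f \<in> borel_measurable M"
  unfolding branch_isometry_def by measurable

lemma branch_coisometry_measurable [measurable]:
  assumes "f \<in> borel_measurable M"
  shows "branch_coisometry f \<in> borel_measurable M"
proof -
  have "(\<lambda>x. f (g x)) \<in> borel_measurable (restrict_space M D)"
    using g_measurable assms by (rule measurable_compose)
  then have "(\<lambda>x. indicator D x *\<^sub>R f (g x)) \<in> borel_measurable M"
    by (simp add: borel_measurable_restrict_space_iff)
  then have "(\<lambda>x. complex_of_real (sqrt c) * (indicator D x *\<^sub>R f (g x))) \<in> borel_measurable M"
    by (intro borel_measurable_times) auto
  moreover have "branch_coisometry f = (\<lambda>x. complex_of_real (sqrt c) * (indicator D x *\<^sub>R f (g x)))"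
    by (auto simp: branch_coisometry_def)
  ultimately show ?thesis by simp
qed

lemma branch_isometry_coisometry:
  "branch_isometry (branch_coisometry f) x = (if x \<in> g ` D then f x else 0)"
  using c_pos t_range[of x] g_t[of x] by (simp add: branch_isometry_def branch_coisometry_def)

lemma branch_coisometry_isometry:
  "branch_coisometry (branch_isometry f) x = (if x \<in> D then f x else 0)"
  using c_pos t_g[of x] by (simp add: branch_isometry_def branch_coisometry_def)

lemma branch_isometry_coisometry_isometry:
  "branch_isometry (branch_coisometry (branch_isometry f)) = branch_isometry f"
  by (rule ext) (simp add: branch_isometry_coisometry, simp add: branch_isometry_def)

lemma norm_branch_isometry:
  assumes f: "f \<in> borel_measurable M"
  shows "integrable M (\<lambda>x. (norm (branch_isometry f x))\<^sup>2)
      \<longleftrightarrow> integrable M (\<lambda>x. indicator D x *\<^sub>R (norm (f x))\<^sup>2)"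
    and "(\<integral>x. (norm (branch_isometry f x))\<^sup>2 \<partial>M)
      = (\<integral>x. indicator D x *\<^sub>R (norm (f x))\<^sup>2 \<partial>M)"
proof -
  let ?h = "\<lambda>x. (norm (f x))\<^sup>2 / c"
  have eq: "(norm (branch_isometry f x))\<^sup>2 = indicator (g ` D) x *\<^sub>R ?h (t x)" for x
    using c_pos by (simp add: branch_isometry_def norm_divide power_divide)
  have h: "?h \<in> borel_measurable M"
    using f by measurable
  have eq': "(\<lambda>x. indicator D x *\<^sub>R ?h x) = (\<lambda>x. 1 / c * (indicator D x *\<^sub>R (norm (f x))\<^sup>2))"
    by simp
  show "integrable M (\<lambda>x. (norm (branch_isometry f x))\<^sup>2)
      \<longleftrightarrow> integrable M (\<lambda>x. indicator D x *\<^sub>R (norm (f x))\<^sup>2)"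
    unfolding eq integrable_pullback_iff[OF h] eq' integrable_mult_left_iff using c_pos by simp
  show "(\<integral>x. (norm (branch_isometry f x))\<^sup>2 \<partial>M)
      = (\<integral>x. indicator D x *\<^sub>R (norm (f x))\<^sup>2 \<partial>M)"
    unfolding eq integral_pullback[OF h] eq' using c_pos by simp
qed

lemma norm_branch_coisometry:
  assumes f: "f \<in> borel_measurable M"
  shows "integrable M (\<lambda>x. (norm (branch_coisometry f x))\<^sup>2)
      \<longleftrightarrow> integrable M (\<lambda>x. indicator (g ` D) x *\<^sub>R (norm (f x))\<^sup>2)"
    and "(\<integral>x. (norm (branch_coisometry f x))\<^sup>2 \<partial>M)
      = (\<integral>x. indicator (g ` D) x *\<^sub>R (norm (f x))\<^sup>2 \<partial>M)"
proof -
  have 1: "indicator D x *\<^sub>R (norm (branch_coisometry f x))\<^sup>2 = (norm (branch_coisometry f x))\<^sup>2" for x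
    by (simp add: branch_coisometry_def)
  have 2: "(norm (branch_isometry (branch_coisometry f) x))\<^sup>2 = indicator (g ` D) x *\<^sub>R (norm (f x))\<^sup>2" for x
    by (simp add: branch_isometry_coisometry)
  note * = norm_branch_isometry[OF branch_coisometry_measurable[OF f], unfolded 1 2]
  show "integrable M (\<lambda>x. (norm (branch_coisometry f x))\<^sup>2)
      \<longleftrightarrow> integrable M (\<lambda>x. indicator (g ` D) x *\<^sub>R (norm (f x))\<^sup>2)"
    "(\<integral>x. (norm (branch_coisometry f x))\<^sup>2 \<partial>M)
      = (\<integral>x. indicator (g ` D) x *\<^sub>R (norm (f x))\<^sup>2 \<partial>M)"
    using * by simp_all
qed

lemma branch_isometry_L2: "f \<in> L2 M \<Longrightarrow> branch_isometry f \<in> L2 M"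
  using norm_branch_isometry(1)[of f] L2_restrict(1)[of f M D]
  by (auto simp: L2_def intro: branch_isometry_measurable)

lemma branch_coisometry_L2: "f \<in> L2 M \<Longrightarrow> branch_coisometry f \<in> L2 M"
  using norm_branch_coisometry(1)[of f] L2_restrict(1)[of f M "g ` D"]
  by (auto simp: L2_def intro: branch_coisometry_measurable)

lemma L2_bounded_operator_branch_isometry: "L2_bounded_operator M branch_isometry"
  unfolding L2_bounded_operator_def
proof (intro conjI ballI allI impI)
  show "branch_isometry f \<in> L2 M" if "f \<in> L2 M" for f
    using that by (rule branch_isometry_L2)
  show "L2_eq M (branch_isometry f) (branch_isometry k)" if "L2_eq M f k" for f k
  proof -
    have "AE x in M. x \<in> D \<longrightarrow> f x = k x"
      using that unfolding L2_eq_def by eventually_elim simp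
    from AE_pullback[OF this] show ?thesis
      unfolding L2_eq_def by eventually_elim (simp add: branch_isometry_def)
  qed
  show "L2_eq M (branch_isometry (\<lambda>x. f x + k x)) (\<lambda>x. branch_isometry f x + branch_isometry k x)"
    for f k by (simp add: L2_eq_def branch_isometry_def add_divide_distrib)
  show "L2_eq M (branch_isometry (\<lambda>x. a * f x)) (\<lambda>x. a * branch_isometry f x)" for a f
    by (simp add: L2_eq_def branch_isometry_def)
  show "\<exists>C. \<forall>f\<in>L2 M. L2_norm M (branch_isometry f) \<le> C * L2_norm M f"
    using norm_branch_isometry(2) L2_restrict(2)[OF _ D_sets]
    by (intro exI[of _ 1]) (auto simp: L2_norm_def L2_def)
qed

lemma L2_bounded_operator_branch_coisometry: "L2_bounded_operator M branch_coisometry"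
  unfolding L2_bounded_operator_def
proof (intro conjI ballI allI impI)
  show "branch_coisometry f \<in> L2 M" if "f \<in> L2 M" for f
    using that by (rule branch_coisometry_L2)
  show "L2_eq M (branch_coisometry f) (branch_coisometry k)"
    if "f \<in> L2 M" "k \<in> L2 M" "L2_eq M f k" for f k
  proof -
    from \<open>L2_eq M f k\<close> obtain Z where Z: "{x \<in> space M. f x \<noteq> k x} \<subseteq> Z" "Z \<in> null_sets M"
      unfolding L2_eq_def by (auto elim!: AE_E)
    \<comment> \<open>Preimages of null sets under \<open>g\<close> are null, since \<open>c * \<mu>(E) = \<mu>(g(E))\<close> and \<open>c > 0\<close>.\<close>
    define E where "E = {x \<in> D. g x \<in> Z}"
    have "E = g -` Z \<inter> space (restrict_space M D)"
      using D_subset by (auto simp: E_def space_restrict_space)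
    also have "\<dots> \<in> sets (restrict_space M D)"
      using g_measurable Z(2) by (intro measurable_sets) auto
    finally have E: "E \<in> sets M" "E \<subseteq> D"
      by (simp add: sets_restrict_space_iff, simp add: E_def)
    have "emeasure M (g ` E) \<le> emeasure M Z"
      using Z(2) by (intro emeasure_mono) (auto simp: E_def)
    then have "ennreal c * emeasure M E = 0"
      using Z(2) E by (simp add: emeasure_image[symmetric] null_sets_def)
    then have "E \<in> null_sets M"
      using E c_pos by (auto simp: null_sets_def)
    then show ?thesis
      unfolding L2_eq_def
      by (rule AE_I') (use Z(1) range_subset in \<open>auto simp: branch_coisometry_def E_def split: if_splits\<close>)
  qed
  show "L2_eq M (branch_coisometry (\<lambda>x. f x + k x)) (\<lambda>x. branch_coisometry f x + branch_coisometry k x)"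
    for f k by (simp add: L2_eq_def branch_coisometry_def distrib_left)
  show "L2_eq M (branch_coisometry (\<lambda>x. a * f x)) (\<lambda>x. a * branch_coisometry f x)" for a f
    by (simp add: L2_eq_def branch_coisometry_def)
  show "\<exists>C. \<forall>f\<in>L2 M. L2_norm M (branch_coisometry f) \<le> C * L2_norm M f"
    using norm_branch_coisometry(2) L2_restrict(2)[OF _ range_sets]
    by (intro exI[of _ 1]) (auto simp: L2_norm_def L2_def)
qed

lemma L2_is_adjoint_branch: "L2_is_adjoint M branch_isometry branch_coisometry"
  unfolding L2_is_adjoint_def
proof (intro conjI ballI L2_bounded_operator_branch_coisometry)
  fix f k assume "f \<in> L2 M" "k \<in> L2 M"
  then have [measurable]: "f \<in> borel_measurable M" "k \<in> borel_measurable M"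
    by (auto simp: L2_def)
  define h where "h = (\<lambda>x. f x * cnj (branch_coisometry k x) / complex_of_real c)"
  have cc: "complex_of_real (sqrt c) * complex_of_real (sqrt c) = complex_of_real c"
    using c_pos by (simp flip: of_real_mult)
  have 1: "branch_isometry f x * cnj (k x) = indicator (g ` D) x *\<^sub>R h (t x)" for x
    using c_pos t_range[of x] g_t[of x]
    by (auto simp: h_def branch_isometry_def branch_coisometry_def field_simps simp flip: cc)
  have 2: "c *\<^sub>R (indicator D x *\<^sub>R h x) = f x * cnj (branch_coisometry k x)" for x
    using c_pos by (simp add: h_def branch_coisometry_def scaleR_conv_of_real)
  have "cnj \<in> borel_measurable borel"
    by (intro borel_measurable_continuous_onI continuous_intros)
  then have [measurable]: "(\<lambda>x. cnj (branch_coisometry k x)) \<in> borel_measurable M"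
    by (rule measurable_compose[rotated]) measurable
  have "h \<in> borel_measurable M"
    unfolding h_def by (intro borel_measurable_divide borel_measurable_times) auto
  from integral_pullback[OF this]
  show "L2_inner M (branch_isometry f) k = L2_inner M f (branch_coisometry k)"
    unfolding L2_inner_def 1 integral_scaleR_right[symmetric] 2 .
qed

text \<open>
  Without \<open>\<sigma>\<close>-finiteness a Radon--Nikodym derivative is not unique almost
  everywhere: if every measurable subset of \<open>D\<close> has measure \<open>0\<close> or
  \<open>\<infinity>\<close>, then every positive measurable function is one. It is unique on sets
  of finite measure, and an \<open>L\<^sup>2\<close> function vanishes outside a countable union
  of such sets. Hence it equals \<open>c\<close> wherever it can affect the operator of the
  branch.
\<close>

lemma RN_deriv_eq_ratio:
  assumes \<Phi>: "has_RN_deriv_comp M D g \<Phi>" and f: "f \<in> L2 M"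
  shows "AE x in M. x \<in> D \<longrightarrow> f x \<noteq> 0 \<longrightarrow> \<Phi> x = c"
proof -
  have [measurable]: "f \<in> borel_measurable M" and fi: "integrable M (\<lambda>x. (norm (f x))\<^sup>2)"
    using f by (auto simp: L2_def)
  have "(\<lambda>x. ennreal (\<Phi> x)) \<in> borel_measurable (restrict_space M D)"
    using \<Phi> by (auto simp: has_RN_deriv_comp_def)
  then have \<Phi>_meas [measurable]: "(\<lambda>x. ennreal (\<Phi> x) * indicator D x) \<in> borel_measurable M"
    by (simp add: borel_measurable_restrict_space_iff_ennreal)
  have eq_c: "\<Phi> x = c" if "ennreal c = ennreal (\<Phi> x)" for x
    using that c_pos ennreal_inj[of c "\<Phi> x"] by (cases "0 \<le> \<Phi> x") (auto simp: ennreal_neg)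
  have "AE x in M. x \<in> D \<longrightarrow> 1 / real (Suc n) < (norm (f x))\<^sup>2 \<longrightarrow> \<Phi> x = c" for n
  proof -
    define E where "E = {x \<in> space M. 1 / real (Suc n) \<le> (norm (f x))\<^sup>2} \<inter> D"
    have E [measurable]: "E \<in> sets M" unfolding E_def by measurable
    have "emeasure M {x \<in> space M. 1 / real (Suc n) \<le> (norm (f x))\<^sup>2}
        \<le> ennreal (1 / (1 / real (Suc n)) * (\<integral>x. (norm (f x))\<^sup>2 \<partial>M))"
      by (rule integral_Markov_inequality[OF fi]) auto
    also have "\<dots> < \<infinity>"
      by simp
    finally have "emeasure M E < \<infinity>"
      by (rule le_less_trans[rotated]) (auto intro!: emeasure_mono simp: E_def)
    \<comment> \<open>On the set \<open>E\<close> of finite measure, \<open>c\<close> and \<open>\<Phi>\<close> are densities of the same measure.\<close>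
    have "AE x in M. ennreal c * indicator E x = ennreal (\<Phi> x) * indicator D x * indicator E x"
    proof (subst finite_density_unique[symmetric])
      show "density M (\<lambda>x. ennreal c * indicator E x)
          = density M (\<lambda>x. ennreal (\<Phi> x) * indicator D x * indicator E x)"
      proof (rule measure_eqI)
        fix F assume "F \<in> sets (density M (\<lambda>x. ennreal c * indicator E x))"
        then have [measurable]: "F \<in> sets M" by simp
        have EF: "E \<inter> F \<in> sets M" "E \<inter> F \<subseteq> D"
          by (simp, auto simp: E_def)
        have "emeasure (density M (\<lambda>x. ennreal c * indicator E x)) F
            = (\<integral>\<^sup>+x. ennreal c * indicator (E \<inter> F) x \<partial>M)"
          by (simp add: emeasure_density indicator_inter_arith mult.assoc)
        also have "\<dots> = emeasure M (g ` (E \<inter> F))"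
          using EF by (simp add: emeasure_image nn_integral_cmult_indicator)
        also have "\<dots> = (\<integral>\<^sup>+x\<in>E \<inter> F. ennreal (\<Phi> x) \<partial>M)"
          using \<Phi> EF unfolding has_RN_deriv_comp_def by blast
        also have "\<dots> = (\<integral>\<^sup>+x. ennreal (\<Phi> x) * indicator D x * indicator E x * indicator F x \<partial>M)"
          by (intro nn_integral_cong) (auto simp: E_def indicator_def)
        also have "\<dots> = emeasure (density M (\<lambda>x. ennreal (\<Phi> x) * indicator D x * indicator E x)) F"
          by (simp add: emeasure_density)
        finally show "emeasure (density M (\<lambda>x. ennreal c * indicator E x)) F
            = emeasure (density M (\<lambda>x. ennreal (\<Phi> x) * indicator D x * indicator E x)) F" .
      qed simp
      show "(\<integral>\<^sup>+x. ennreal c * indicator E x \<partial>M) \<noteq> \<infinity>"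
        using \<open>emeasure M E < \<infinity>\<close>
        by (simp add: nn_integral_cmult_indicator ennreal_mult_eq_top_iff less_top)
    qed auto
    then show ?thesis
    proof eventually_elim
      case (elim x)
      show ?case
      proof (intro impI)
        assume x: "x \<in> D" "1 / real (Suc n) < (norm (f x))\<^sup>2"
        then have "x \<in> E"
          unfolding E_def using D_subset by (simp add: subset_eq)
        with elim x(1) show "\<Phi> x = c"
          by (intro eq_c) simp
      qed
    qed
  qed
  then have "AE x in M. \<forall>n. x \<in> D \<longrightarrow> 1 / real (Suc n) < (norm (f x))\<^sup>2 \<longrightarrow> \<Phi> x = c"
    unfolding AE_all_countable by blast
  then show ?thesis
  proof eventually_elim
    case (elim x)
    show ?case
    proof (intro impI)
      assume "x \<in> D" "f x \<noteq> 0"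
      then have "0 < (norm (f x))\<^sup>2" by simp
      then obtain n where "1 / real (Suc n) < (norm (f x))\<^sup>2"
        using reals_Archimedean unfolding inverse_eq_divide by blast
      with elim \<open>x \<in> D\<close> show "\<Phi> x = c" by blast
    qed
  qed
qed

text \<open>
  The operator built from any Radon--Nikodym derivative is, up to equality almost everywhere, the
  one built from \<open>c\<close>.
\<close>

lemma sbfs_operator_eq_branch_isometry:
  assumes \<Phi>: "has_RN_deriv_comp M D g \<Phi>" and f: "f \<in> L2 M"
  shows "sbfs_operator (g ` D) \<Phi> t f \<in> borel_measurable M"
    and "L2_eq M (sbfs_operator (g ` D) \<Phi> t f) (branch_isometry f)"
proof -
  have [measurable]: "f \<in> borel_measurable M"
    using f by (auto simp: L2_def)
  have [measurable]: "(\<lambda>x. indicator D x *\<^sub>R \<Phi> x) \<in> borel_measurable M"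
    using \<Phi> by (auto simp: has_RN_deriv_comp_def borel_measurable_restrict_space_iff)
  \<comment> \<open>The derivative is measurable on \<open>D\<close> only; on the range it is evaluated at \<open>t x \<in> D\<close>.\<close>
  have "sbfs_operator (g ` D) \<Phi> t f = (\<lambda>x. if x \<in> g ` D then
      complex_of_real ((indicator D (t x) *\<^sub>R \<Phi> (t x)) powr (- 1 / 2)) * f (t x) else 0)"
    using t_range by (auto simp: sbfs_operator_def fun_eq_iff)
  moreover have "\<dots> \<in> borel_measurable M"
    by measurable
  ultimately show "sbfs_operator (g ` D) \<Phi> t f \<in> borel_measurable M"
    by simp
  have "c powr (- 1 / 2) = 1 / sqrt c"
    using c_pos by (simp add: powr_minus_divide powr_half_sqrt)
  then have "sbfs_operator (g ` D) \<Phi> t f x = branch_isometry f x"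
    if "x \<in> g ` D \<longrightarrow> f (t x) \<noteq> 0 \<longrightarrow> \<Phi> (t x) = c" for x
    using that by (cases "x \<in> g ` D"; cases "f (t x) = 0")
      (simp_all add: sbfs_operator_def branch_isometry_def)
  then show "L2_eq M (sbfs_operator (g ` D) \<Phi> t f) (branch_isometry f)"
    unfolding L2_eq_def
    by (intro eventually_mono[OF AE_pullback[OF RN_deriv_eq_ratio[OF assms]]])
qed

end

section \<open>Cuntz--Krieger relations for scaling branches\<close>

text \<open>
  Finitely many scaling branches with a common coding map \<open>t\<close>, whose ranges form a
  partition of the space.
\<close>

locale scaling_branching_system =
  fixes M :: "'a measure" and I :: "'i set" and D :: "'i \<Rightarrow> 'a set" and g :: "'i \<Rightarrow> 'a \<Rightarrow> 'a"
    and t :: "'a \<Rightarrow> 'a" and c :: "'i \<Rightarrow> real"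
  assumes finite_index: "finite I"
    and branch: "\<And>\<alpha>. \<alpha> \<in> I \<Longrightarrow> scaling_branch M (D \<alpha>) (g \<alpha>) t (c \<alpha>)"
    and disjoint_ranges: "\<And>\<alpha> \<beta>. \<alpha> \<in> I \<Longrightarrow> \<beta> \<in> I \<Longrightarrow> \<alpha> \<noteq> \<beta> \<Longrightarrow> g \<alpha> ` D \<alpha> \<inter> g \<beta> ` D \<beta> = {}"
    and ranges_cover: "space M \<subseteq> (\<Union>\<alpha>\<in>I. g \<alpha> ` D \<alpha>)"
begin

lemma has_RN_deriv_comp_ratio:
  assumes "\<alpha> \<in> I"
  shows "has_RN_deriv_comp M (D \<alpha>) (g \<alpha>) (\<lambda>_. c \<alpha>)"
proof -
  interpret scaling_branch M "D \<alpha>" "g \<alpha>" t "c \<alpha>"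
    using assms by (rule branch)
  show ?thesis
    unfolding has_RN_deriv_comp_def
    using image_sets emeasure_image by (auto simp: nn_integral_cmult_indicator)
qed

lemma semibranching: "semibranching_function_system M I D g"
  unfolding semibranching_function_system_def
proof (intro conjI ballI impI)
  fix \<alpha> assume "\<alpha> \<in> I"
  then interpret scaling_branch M "D \<alpha>" "g \<alpha>" t "c \<alpha>"
    by (rule branch)
  show "D \<alpha> \<in> sets M" "g \<alpha> \<in> measurable (restrict_space M (D \<alpha>)) M" "g \<alpha> ` D \<alpha> \<in> sets M"
    by (fact D_sets g_measurable range_sets)+
  show "\<exists>\<Phi>. has_RN_deriv_comp M (D \<alpha>) (g \<alpha>) \<Phi> \<and> (AE x in M. x \<in> D \<alpha> \<longrightarrow> 0 < \<Phi> x)"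
    using has_RN_deriv_comp_ratio[OF \<open>\<alpha> \<in> I\<close>] c_pos by auto
next
  have "space M - (\<Union>\<alpha>\<in>I. g \<alpha> ` D \<alpha>) = {}"
    using ranges_cover by blast
  then show "emeasure M (space M - (\<Union>\<alpha>\<in>I. g \<alpha> ` D \<alpha>)) = 0"
    by (metis emeasure_empty)
qed (simp_all add: finite_index disjoint_ranges)

lemma sum_over_ranges:
  fixes w :: "'i \<Rightarrow> complex"
  assumes "\<beta> \<in> I" "x \<in> g \<beta> ` D \<beta>"
  shows "(\<Sum>\<alpha>\<in>I. w \<alpha> * (if x \<in> g \<alpha> ` D \<alpha> then y else 0)) = w \<beta> * y"
proof -
  have "w \<alpha> * (if x \<in> g \<alpha> ` D \<alpha> then y else 0) = (if \<alpha> = \<beta> then w \<beta> * y else 0)" if "\<alpha> \<in> I" for \<alpha>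
    using assms disjoint_ranges[OF that assms(1)] by auto
  then have "(\<Sum>\<alpha>\<in>I. w \<alpha> * (if x \<in> g \<alpha> ` D \<alpha> then y else 0))
      = (\<Sum>\<alpha>\<in>I. if \<alpha> = \<beta> then w \<beta> * y else 0)"
    by (rule sum.cong[OF refl])
  also have "\<dots> = w \<beta> * y"
    using assms(1) finite_index by simp
  finally show ?thesis .
qed

text \<open>
  The incidence hypothesis says that each domain \<open>D \<alpha>\<close> is the union of the
  ranges \<open>g \<beta> ` D \<beta>\<close> with \<open>B \<alpha> \<beta> = 1\<close>, all
  other ranges being disjoint from it; entries \<open>B \<alpha> \<beta>\<close> for an empty
  range are irrelevant.
\<close>

theorem cuntz_krieger:
  assumes incidence: "\<And>\<alpha> \<beta> x. \<alpha> \<in> I \<Longrightarrow> \<beta> \<in> I \<Longrightarrow> x \<in> g \<beta> ` D \<beta> \<Longrightarrow> B \<alpha> \<beta> = of_bool (x \<in> D \<alpha>)"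
    and \<Phi>: "\<And>\<alpha>. \<alpha> \<in> I \<Longrightarrow> has_RN_deriv_comp M (D \<alpha>) (g \<alpha>) (\<Phi> \<alpha>)"
  shows "cuntz_krieger_representation M I B (\<lambda>\<alpha>. sbfs_operator (g \<alpha> ` D \<alpha>) (\<Phi> \<alpha>) t)"
proof -
  define S where "S \<alpha> = sbfs_operator (g \<alpha> ` D \<alpha>) (\<Phi> \<alpha>) t" for \<alpha>
  define T where "T \<alpha> = scaling_branch.branch_isometry (D \<alpha>) (g \<alpha>) t (c \<alpha>)" for \<alpha>
  define T' where "T' \<alpha> = scaling_branch.branch_coisometry (D \<alpha>) (g \<alpha>) (c \<alpha>)" for \<alpha>
  have T: "L2_bounded_operator M (T \<alpha>)" "L2_bounded_operator M (T' \<alpha>)"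
      "L2_is_adjoint M (T \<alpha>) (T' \<alpha>)" if "\<alpha> \<in> I" for \<alpha>
    using scaling_branch.L2_bounded_operator_branch_isometry[OF branch[OF that]]
      scaling_branch.L2_bounded_operator_branch_coisometry[OF branch[OF that]]
      scaling_branch.L2_is_adjoint_branch[OF branch[OF that]]
    by (simp_all add: T_def T'_def)
  have TT': "T \<alpha> (T' \<alpha> f) x = (if x \<in> g \<alpha> ` D \<alpha> then f x else 0)"
    and T'T: "T' \<alpha> (T \<alpha> f) x = (if x \<in> D \<alpha> then f x else 0)"
    and TT'T: "T \<alpha> (T' \<alpha> (T \<alpha> f)) = T \<alpha> f" if "\<alpha> \<in> I" for \<alpha> f x
    using scaling_branch.branch_isometry_coisometry[OF branch[OF that]]
      scaling_branch.branch_coisometry_isometry[OF branch[OF that]]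
      scaling_branch.branch_isometry_coisometry_isometry[OF branch[OF that]]
    by (simp_all add: T_def T'_def)
  have S: "S \<alpha> f \<in> borel_measurable M" "L2_eq M (S \<alpha> f) (T \<alpha> f)"
    if "\<alpha> \<in> I" "f \<in> L2 M" for \<alpha> f
    using scaling_branch.sbfs_operator_eq_branch_isometry[OF branch[OF that(1)] \<Phi>[OF that(1)] that(2)]
    by (simp_all add: S_def T_def)
  have S_bounded: "L2_bounded_operator M (S \<alpha>)" if "\<alpha> \<in> I" for \<alpha>
    using L2_bounded_operator_cong[OF T(1)[OF that] S(1)[OF that] S(2)[OF that]] .
  have T'S: "L2_eq M (T' \<alpha> (S \<alpha> f)) (T' \<alpha> (T \<alpha> f))" if "\<alpha> \<in> I" "f \<in> L2 M" for \<alpha> f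
    using that by (intro L2_bounded_operator_respects[OF T(2)] S(2) L2_bounded_operator_L2[OF S_bounded]
        L2_bounded_operator_L2[OF T(1)])
  have ST': "AE x in M. \<forall>\<beta>\<in>I. S \<beta> (T' \<beta> f) x = (if x \<in> g \<beta> ` D \<beta> then f x else 0)"
    if "f \<in> L2 M" for f
  proof (rule AE_finite_allI[OF finite_index])
    fix \<beta> assume "\<beta> \<in> I"
    then show "AE x in M. S \<beta> (T' \<beta> f) x = (if x \<in> g \<beta> ` D \<beta> then f x else 0)"
      using S(2)[OF \<open>\<beta> \<in> I\<close> L2_bounded_operator_L2[OF T(2)[OF \<open>\<beta> \<in> I\<close>] that]]
      unfolding L2_eq_def TT'[OF \<open>\<beta> \<in> I\<close>] by simp
  qed
  show ?thesis
    unfolding cuntz_krieger_representation_def S_def[symmetric]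
  proof (intro exI[of _ T'] conjI ballI)
    fix \<alpha> assume \<alpha>: "\<alpha> \<in> I"
    show "L2_bounded_operator M (S \<alpha>)"
      using \<alpha> by (rule S_bounded)
    show "L2_is_adjoint M (S \<alpha>) (T' \<alpha>)"
      using L2_is_adjoint_cong[OF T(1)[OF \<alpha>] S(1)[OF \<alpha>] S(2)[OF \<alpha>] T(3)[OF \<alpha>]] .
    fix f assume f: "f \<in> L2 M"
    have Sf: "S \<alpha> f \<in> L2 M" "T \<alpha> f \<in> L2 M"
      using L2_bounded_operator_L2 S_bounded T(1) \<alpha> f by blast+
    then have T'Sf: "T' \<alpha> (S \<alpha> f) \<in> L2 M" "T' \<alpha> (T \<alpha> f) \<in> L2 M"
      using L2_bounded_operator_L2 T(2) \<alpha> by blast+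
    have "L2_eq M (S \<alpha> (T' \<alpha> (S \<alpha> f))) (T \<alpha> (T' \<alpha> (S \<alpha> f)))"
      using \<alpha> T'Sf(1) by (rule S(2))
    also have "L2_eq M (T \<alpha> (T' \<alpha> (S \<alpha> f))) (T \<alpha> (T' \<alpha> (T \<alpha> f)))"
      using T(1)[OF \<alpha>] T'Sf T'S[OF \<alpha> f] by (rule L2_bounded_operator_respects)
    also have "L2_eq M (T \<alpha> (T' \<alpha> (T \<alpha> f))) (S \<alpha> f)"
      unfolding TT'T[OF \<alpha>] using S(2)[OF \<alpha> f] by (rule L2_eq_sym)
    finally show "L2_eq M (S \<alpha> (T' \<alpha> (S \<alpha> f))) (S \<alpha> f)" .
    show "L2_eq M (T' \<alpha> (S \<alpha> f)) (\<lambda>x. \<Sum>\<beta>\<in>I. of_nat (B \<alpha> \<beta>) * S \<beta> (T' \<beta> f) x)"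
      unfolding L2_eq_def using T'S[OF \<alpha> f, unfolded L2_eq_def] ST'[OF f] AE_space
    proof eventually_elim
      case (elim x)
      obtain \<beta> where \<beta>: "\<beta> \<in> I" "x \<in> g \<beta> ` D \<beta>"
        using elim(3) ranges_cover by blast
      have "(\<Sum>\<beta>\<in>I. of_nat (B \<alpha> \<beta>) * S \<beta> (T' \<beta> f) x)
          = (\<Sum>\<beta>\<in>I. of_nat (B \<alpha> \<beta>) * (if x \<in> g \<beta> ` D \<beta> then f x else 0))"
        using elim(2) by (intro sum.cong) auto
      also have "\<dots> = T' \<alpha> (T \<alpha> f) x"
        unfolding sum_over_ranges[OF \<beta>] T'T[OF \<alpha>] incidence[OF \<alpha> \<beta>] by simp
      finally show ?case
        using elim(1) by simp
    qed
  next
    fix f assume f: "f \<in> L2 M"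
    show "L2_eq M (\<lambda>x. \<Sum>\<alpha>\<in>I. S \<alpha> (T' \<alpha> f) x) f"
      unfolding L2_eq_def using ST'[OF f] AE_space
    proof eventually_elim
      case (elim x)
      obtain \<beta> where \<beta>: "\<beta> \<in> I" "x \<in> g \<beta> ` D \<beta>"
        using elim(2) ranges_cover by blast
      have "(\<Sum>\<alpha>\<in>I. S \<alpha> (T' \<alpha> f) x) = (\<Sum>\<alpha>\<in>I. 1 * (if x \<in> g \<alpha> ` D \<alpha> then f x else 0))"
        using elim(1) by (intro sum.cong) auto
      then show ?case
        using sum_over_ranges[OF \<beta>, of "\<lambda>_. 1"] by simp
    qed
  qed
qed

end

section \<open>The branches of the shift\<close>

lemma continuous_tau: "continuous_on UNIV (tau \<alpha>)"
proof -
  obtain i j where \<alpha>: "\<alpha> = (i, j)" by fastforce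
  have *: "continuous_on UNIV (\<lambda>p. case_nat i (h p))"
    if "continuous_on UNIV h" for i and h :: "(nat \<Rightarrow> nat) \<times> (nat \<Rightarrow> nat) \<Rightarrow> nat \<Rightarrow> nat"
  proof (rule continuous_on_coordinatewise_then_product)
    show "continuous_on UNIV (\<lambda>p. case_nat i (h p) k)" for k
      using continuous_on_product_then_coordinatewise[OF that] by (cases k) auto
  qed
  have "tau \<alpha> = (\<lambda>p. (case_nat i (fst p), case_nat j (snd p)))"
    by (auto simp: \<alpha> tau_def fun_eq_iff)
  then show ?thesis
    by (auto intro!: continuous_on_Pair * continuous_on_fst continuous_on_snd continuous_on_id)
qed

lemma continuous_coding_shift: "continuous_on UNIV coding_shift"
proof -
  have *: "continuous_on UNIV (\<lambda>p. shift (h p))"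
    if "continuous_on UNIV h" for h :: "(nat \<Rightarrow> nat) \<times> (nat \<Rightarrow> nat) \<Rightarrow> nat \<Rightarrow> nat"
    unfolding shift_def
    by (intro continuous_on_coordinatewise_then_product continuous_on_product_then_coordinatewise[OF that])
  have "coding_shift = (\<lambda>p. (shift (fst p), shift (snd p)))"
    by (auto simp: coding_shift_def fun_eq_iff)
  moreover have "continuous_on UNIV (\<lambda>p :: (nat \<Rightarrow> nat) \<times> (nat \<Rightarrow> nat). (shift (fst p), shift (snd p)))"
    by (intro continuous_on_Pair * continuous_on_fst continuous_on_snd continuous_on_id)
  ultimately show ?thesis
    by (simp only:)
qed

lemma first_digits_borel:
  "{p :: (nat \<Rightarrow> nat) \<times> (nat \<Rightarrow> nat). fst p 0 = i} \<in> sets borel"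
  "{p :: (nat \<Rightarrow> nat) \<times> (nat \<Rightarrow> nat). snd p 0 = j} \<in> sets borel"
proof -
  have "continuous_on UNIV (\<lambda>p :: (nat \<Rightarrow> nat) \<times> (nat \<Rightarrow> nat). fst p 0)"
    "continuous_on UNIV (\<lambda>p :: (nat \<Rightarrow> nat) \<times> (nat \<Rightarrow> nat). snd p 0)"
    by (rule continuous_on_product_then_coordinatewise[OF continuous_on_fst[OF continuous_on_id]])
      (rule continuous_on_product_then_coordinatewise[OF continuous_on_snd[OF continuous_on_id]])
  then have "open ((\<lambda>p :: (nat \<Rightarrow> nat) \<times> (nat \<Rightarrow> nat). fst p 0) -` {i})"
    "open ((\<lambda>p :: (nat \<Rightarrow> nat) \<times> (nat \<Rightarrow> nat). snd p 0) -` {j})"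
    by (auto intro: open_vimage open_discrete)
  then show "{p :: (nat \<Rightarrow> nat) \<times> (nat \<Rightarrow> nat). fst p 0 = i} \<in> sets borel"
    "{p :: (nat \<Rightarrow> nat) \<times> (nat \<Rightarrow> nat). snd p 0 = j} \<in> sets borel"
    by (auto simp: vimage_def)
qed

lemma coding_shift_tau: "coding_shift (tau \<alpha> p) = p"
  by (cases \<alpha>; cases p) (simp add: coding_shift_def tau_def shift_def)

lemma shift_Lambda: "x \<in> Lambda N A \<Longrightarrow> shift x \<in> Lambda N A"
  by (simp add: Lambda_def shift_def)

lemma case_nat_shift: "case_nat (x 0) (shift x) = x"
  by (auto simp: shift_def split: nat.splits)

text \<open>
  Only the first transition has to be checked when a digit is prepended to an admissible sequence.
\<close>

lemma case_nat_Lambda: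
  "case_nat i x \<in> Lambda N A \<longleftrightarrow> i < N \<and> A i (x 0) = 1 \<and> x \<in> Lambda N A"
proof -
  have all: "(\<forall>k. P k) \<longleftrightarrow> P 0 \<and> (\<forall>k. P (Suc k))" for P :: "nat \<Rightarrow> bool"
    by (metis not0_implies_Suc)
  show ?thesis
    unfolding Lambda_def mem_Collect_eq all[of "\<lambda>k. case_nat i x k < N"]
      all[of "\<lambda>k. A (case_nat i x k) (case_nat i x (Suc k)) = 1"]
    by auto
qed

lemma tau_Xi: "tau (i, x 0) (Xi x) = Xi (case_nat i x)"
  by (simp add: tau_def Xi_def case_nat_shift) (simp add: shift_def)

text \<open>
  Prepending \<open>(i, j)\<close> to \<open>(x, \<sigma>(x))\<close> gives a pair of the same
  form only if \<open>j\<close> is the first digit of \<open>x\<close>, because the second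
  sequence must be the shift of the first; the result is then the point over \<open>i x\<close>.
\<close>

lemma tau_dom_eq:
  assumes "(i, j) \<in> admissible_pairs N A"
  shows "tau_dom N A (i, j) = {p \<in> Xi ` Lambda N A. fst p 0 = j}"
proof (intro equalityI subsetI)
  fix p assume "p \<in> tau_dom N A (i, j)"
  then obtain x y where p: "p = Xi x" "x \<in> Lambda N A" "tau (i, j) (Xi x) = Xi y"
    by (auto simp: tau_dom_def)
  have y: "y = case_nat i x" "shift y = case_nat j (shift x)"
    using p(3) by (auto simp: tau_def Xi_def)
  have "x 0 = shift y 0"
    by (simp add: y(1) shift_def)
  also have "\<dots> = j"
    by (simp only: y(2) nat.case)
  finally have "x 0 = j" .
  with p show "p \<in> {p \<in> Xi ` Lambda N A. fst p 0 = j}"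
    by (auto simp: Xi_def)
next
  fix p assume "p \<in> {p \<in> Xi ` Lambda N A. fst p 0 = j}"
  then obtain x where p: "p = Xi x" "x \<in> Lambda N A" "x 0 = j"
    by (auto simp: Xi_def)
  have "tau (i, j) p = Xi (case_nat i x)"
    using tau_Xi[of i x] p by simp
  moreover have "case_nat i x \<in> Lambda N A"
    using assms p by (simp add: case_nat_Lambda admissible_pairs_def)
  ultimately show "p \<in> tau_dom N A (i, j)"
    using p by (auto simp: tau_dom_def)
qed

lemma coding_shift_Xi: "coding_shift (Xi x) = Xi (shift x)"
  by (simp add: coding_shift_def Xi_def)

lemma tau_coding_shift:
  assumes "p \<in> Xi ` Lambda N A"
  shows "tau (fst p 0, snd p 0) (coding_shift p) = p"
  using assms by (auto simp: tau_def Xi_def coding_shift_def case_nat_shift)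

lemma tau_image_eq:
  assumes \<alpha>: "(i, j) \<in> admissible_pairs N A" and E: "E \<subseteq> tau_dom N A (i, j)"
  shows "tau (i, j) ` E = {p \<in> Xi ` Lambda N A. fst p 0 = i \<and> snd p 0 = j \<and> coding_shift p \<in> E}"
proof (intro equalityI subsetI)
  fix q assume "q \<in> tau (i, j) ` E"
  then obtain p where p: "p \<in> E" "q = tau (i, j) p" by blast
  then have "q \<in> Xi ` Lambda N A"
    using E by (auto simp: tau_dom_def)
  moreover have "fst q 0 = i" "snd q 0 = j"
    by (cases p, simp add: p tau_def)+
  ultimately show "q \<in> {p \<in> Xi ` Lambda N A. fst p 0 = i \<and> snd p 0 = j \<and> coding_shift p \<in> E}"
    using p by (simp add: coding_shift_tau)
next
  fix q assume "q \<in> {p \<in> Xi ` Lambda N A. fst p 0 = i \<and> snd p 0 = j \<and> coding_shift p \<in> E}"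
  then show "q \<in> tau (i, j) ` E"
    using tau_coding_shift[of q N A] by (metis (mono_tags, lifting) imageI mem_Collect_eq)
qed

lemma tau_range_eq:
  assumes "(i, j) \<in> admissible_pairs N A"
  shows "tau (i, j) ` tau_dom N A (i, j) = {p \<in> Xi ` Lambda N A. fst p 0 = i \<and> snd p 0 = j}"
proof -
  have "coding_shift p \<in> tau_dom N A (i, j) \<longleftrightarrow> snd p 0 = j" if "p \<in> Xi ` Lambda N A" for p
  proof -
    have "coding_shift p \<in> Xi ` Lambda N A"
      using that by (auto simp: coding_shift_Xi shift_Lambda)
    moreover have "fst (coding_shift p) 0 = snd p 0"
      using that by (auto simp: coding_shift_def Xi_def)
    ultimately show ?thesis
      by (simp add: tau_dom_eq[OF assms])
  qed
  then show ?thesis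
    unfolding tau_image_eq[OF assms subset_refl] by blast
qed

lemma sets_Xi_measure: "sets (Xi_measure N A) = sets (restrict_space borel (Xi ` Lambda N A))"
  by (simp add: Xi_measure_def sets_hausdorff_measure_mult)

lemma space_Xi_measure: "space (Xi_measure N A) = Xi ` Lambda N A"
  by (simp add: Xi_measure_def space_hausdorff_measure_mult)

lemma borel_Int_sets_Xi_measure:
  "B \<in> sets borel \<Longrightarrow> {p \<in> Xi ` Lambda N A. p \<in> B} \<in> sets (Xi_measure N A)"
  by (auto simp: sets_Xi_measure sets_restrict_space)

lemma coding_shift_measurable: "coding_shift \<in> measurable (Xi_measure N A) (Xi_measure N A)"
proof -
  have "coding_shift \<in> measurable (restrict_space borel (Xi ` Lambda N A)) (restrict_space borel (Xi ` Lambda N A))"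
    using borel_measurable_continuous_onI[OF continuous_coding_shift]
    by (intro measurable_restrict_space3) (auto simp: coding_shift_Xi shift_Lambda)
  then show ?thesis
    by (simp add: measurable_cong_sets[OF sets_Xi_measure sets_Xi_measure])
qed

lemma tau_measurable:
  "tau \<alpha> \<in> measurable (restrict_space (Xi_measure N A) (tau_dom N A \<alpha>)) (Xi_measure N A)"
proof -
  have "tau \<alpha> \<in> measurable (restrict_space (restrict_space borel (Xi ` Lambda N A)) (tau_dom N A \<alpha>))
      (restrict_space borel (Xi ` Lambda N A))"
    using borel_measurable_continuous_onI[OF continuous_tau]
    by (intro measurable_restrict_space2 measurable_restrict_space1)
      (auto simp: tau_dom_def space_restrict_space)
  then show ?thesis
    by (simp add: measurable_cong_sets[OF sets_restrict_space_cong[OF sets_Xi_measure] sets_Xi_measure])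
qed

text \<open>
  On points of the plane, \<open>tau (i, j)\<close> is the similarity \<open>p \<mapsto> (p + (i,
  j)) / N\<close> with ratio \<open>1 / N\<close>, so it multiplies the
  \<open>s\<close>-dimensional measure by \<open>N\<close> to the power \<open>- s\<close>. That
  \<open>s\<close> is the dimension of the set plays no role.
\<close>

lemma scaling_branch_tau:
  assumes N: "2 \<le> N" and \<alpha>: "\<alpha> \<in> admissible_pairs N A"
  shows "scaling_branch (Xi_measure N A) (tau_dom N A \<alpha>) (tau \<alpha>) coding_shift
    ((1 / real N) powr hausdorff_dim (digit_point N ` Xi ` Lambda N A))"
proof -
  obtain i j where ij: "\<alpha> = (i, j)" by fastforce
  note \<alpha>' = \<alpha>[unfolded ij]
  have image: "tau \<alpha> ` E \<in> sets (Xi_measure N A)"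
    if "E \<in> sets (Xi_measure N A)" "E \<subseteq> tau_dom N A \<alpha>" for E
  proof -
    have "tau \<alpha> ` E = {p \<in> Xi ` Lambda N A. p \<in> {p. fst p 0 = i}}
        \<inter> {p \<in> Xi ` Lambda N A. p \<in> {p. snd p 0 = j}}
        \<inter> (coding_shift -` E \<inter> space (Xi_measure N A))"
      using tau_image_eq[OF \<alpha>', of E] that(2) by (auto simp: ij space_Xi_measure)
    also have "\<dots> \<in> sets (Xi_measure N A)"
      by (intro sets.Int borel_Int_sets_Xi_measure first_digits_borel
          measurable_sets[OF coding_shift_measurable that(1)])
    finally show ?thesis .
  qed
  let ?f = "\<lambda>p :: real \<times> real. (1 / real N) *\<^sub>R (p + (real i, real j))"
  have f: "dist (?f p) (?f q) = 1 / real N * dist p q" for p q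
    using N by (simp add: dist_norm flip: scaleR_diff_right)
  have "surj ?f"
  proof (rule surjI)
    show "?f (real N *\<^sub>R p - (real i, real j)) = p" for p
      using N by simp
  qed
  show ?thesis
  proof
    show "0 < (1 / real N) powr hausdorff_dim (digit_point N ` Xi ` Lambda N A)"
      using N by simp
    show "tau_dom N A \<alpha> \<in> sets (Xi_measure N A)"
      unfolding ij tau_dom_eq[OF \<alpha>'] using borel_Int_sets_Xi_measure[OF first_digits_borel(1)[of j]] by simp
    show "emeasure (Xi_measure N A) (tau \<alpha> ` E)
        = ennreal ((1 / real N) powr hausdorff_dim (digit_point N ` Xi ` Lambda N A))
          * emeasure (Xi_measure N A) E"
      if E: "E \<in> sets (Xi_measure N A)" "E \<subseteq> tau_dom N A \<alpha>" for E
      unfolding Xi_measure_def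
    proof (rule emeasure_hausdorff_measure_mult_similarity[OF f _ \<open>surj ?f\<close>])
      show "inj_on (tau \<alpha>) E"
        by (rule inj_on_inverseI) (rule coding_shift_tau)
      show "digit_point N (tau \<alpha> e) = ?f (digit_point N e)" if "e \<in> E" for e
      proof -
        have "e \<in> S_set N A"
          using that E(2) subsetD[OF Xi_Lambda_subset] unfolding tau_dom_def by blast
        then show ?thesis
          using digit_point_tau[OF N, of "fst e" "snd e" A i j]
          by (cases e) (simp add: ij digit_point_def)
      qed
    qed (use N E image[OF E] in \<open>auto simp: sets_Xi_measure\<close>)
  qed (auto intro: tau_measurable coding_shift_measurable image simp: coding_shift_tau)
qed

lemma scaling_branching_system_tau:
  assumes N: "2 \<le> N"
  shows "scaling_branching_system (Xi_measure N A) (admissible_pairs N A) (tau_dom N A) tau coding_shift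
    (\<lambda>_. (1 / real N) powr hausdorff_dim (digit_point N ` Xi ` Lambda N A))"
proof (rule scaling_branching_system.intro)
  have "admissible_pairs N A \<subseteq> {..<N} \<times> {..<N}"
    by (auto simp: admissible_pairs_def)
  then show "finite (admissible_pairs N A)"
    by (rule finite_subset) simp
  show "tau \<alpha> ` tau_dom N A \<alpha> \<inter> tau \<beta> ` tau_dom N A \<beta> = {}"
    if "\<alpha> \<in> admissible_pairs N A" "\<beta> \<in> admissible_pairs N A" "\<alpha> \<noteq> \<beta>" for \<alpha> \<beta>
    using that by (cases \<alpha>; cases \<beta>) (auto simp: tau_range_eq)
  show "space (Xi_measure N A) \<subseteq> (\<Union>\<alpha>\<in>admissible_pairs N A. tau \<alpha> ` tau_dom N A \<alpha>)"
  proof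
    fix p assume p: "p \<in> space (Xi_measure N A)"
    have "(fst p 0, snd p 0) \<in> admissible_pairs N A"
      using p by (auto simp: space_Xi_measure admissible_pairs_def Xi_def Lambda_def shift_def)
    moreover from this have "p \<in> tau (fst p 0, snd p 0) ` tau_dom N A (fst p 0, snd p 0)"
      using p by (simp add: tau_range_eq space_Xi_measure)
    ultimately show "p \<in> (\<Union>\<alpha>\<in>admissible_pairs N A. tau \<alpha> ` tau_dom N A \<alpha>)"
      by blast
  qed
qed (rule scaling_branch_tau[OF N])

theorem proposition2p25:
  fixes N :: nat and A :: "nat \<Rightarrow> nat \<Rightarrow> nat"
  assumes "2 \<le> N"
    and "\<forall>i<N. \<forall>j<N. A i j \<in> {0, 1}"
    and "\<forall>i<N. A i i = 1"
  shows "semibranching_function_system (Xi_measure N A) (admissible_pairs N A) (tau_dom N A) tau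
    \<and> coding_map (Xi_measure N A) (admissible_pairs N A) (tau_dom N A) tau coding_shift
    \<and> (\<forall>\<Phi>. (\<forall>\<alpha>\<in>admissible_pairs N A.
              has_RN_deriv_comp (Xi_measure N A) (tau_dom N A \<alpha>) (tau \<alpha>) (\<Phi> \<alpha>)) \<longrightarrow>
          cuntz_krieger_representation (Xi_measure N A) (admissible_pairs N A) (tilde_matrix A)
            (\<lambda>\<alpha>. sbfs_operator (tau \<alpha> ` tau_dom N A \<alpha>) (\<Phi> \<alpha>) coding_shift))"
proof (intro conjI allI impI)
  interpret scaling_branching_system "Xi_measure N A" "admissible_pairs N A" "tau_dom N A" tau
    coding_shift "\<lambda>_. (1 / real N) powr hausdorff_dim (digit_point N ` Xi ` Lambda N A)"
    using assms(1) by (rule scaling_branching_system_tau)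
  show "semibranching_function_system (Xi_measure N A) (admissible_pairs N A) (tau_dom N A) tau"
    by (rule semibranching)
  show "coding_map (Xi_measure N A) (admissible_pairs N A) (tau_dom N A) tau coding_shift"
    by (simp add: coding_map_def coding_shift_measurable coding_shift_tau)
  fix \<Phi>
  assume \<Phi>: "\<forall>\<alpha>\<in>admissible_pairs N A.
    has_RN_deriv_comp (Xi_measure N A) (tau_dom N A \<alpha>) (tau \<alpha>) (\<Phi> \<alpha>)"
  show "cuntz_krieger_representation (Xi_measure N A) (admissible_pairs N A) (tilde_matrix A)
      (\<lambda>\<alpha>. sbfs_operator (tau \<alpha> ` tau_dom N A \<alpha>) (\<Phi> \<alpha>) coding_shift)"
  proof (rule cuntz_krieger)
    fix \<alpha> \<beta> p
    assume \<alpha>: "\<alpha> \<in> admissible_pairs N A" and \<beta>: "\<beta> \<in> admissible_pairs N A"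
      and p: "p \<in> tau \<beta> ` tau_dom N A \<beta>"
    obtain i j l k where eqs: "\<alpha> = (i, j)" "\<beta> = (l, k)" by fastforce
    have "p \<in> Xi ` Lambda N A" "fst p 0 = l"
      using p \<beta> by (auto simp: eqs tau_range_eq)
    then have "p \<in> tau_dom N A \<alpha> \<longleftrightarrow> j = l"
      using \<alpha> by (auto simp: eqs tau_dom_eq)
    moreover have "A l k = 1"
      using \<beta> by (simp add: eqs admissible_pairs_def)
    ultimately show "tilde_matrix A \<alpha> \<beta> = of_bool (p \<in> tau_dom N A \<alpha>)"
      by (auto simp: tilde_matrix_def eqs)
  qed (use \<Phi> in blast)
qed

end
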